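(* Let $$f(r)=\frac{4\left(1+\tan^2\frac r2\right)\left(1+2\tan^2\frac r2\right)^{3/2}}{3\tan^4\frac r2+9\tan^2\frac r2+6+\cot^2\frac r2},\qquad 0<r<\pi.$$ Then the map $\varphi:(S^2\setminus\{N,S\},f^{-1}(r)(dr^2+\sin^2r\,d\theta^2))\longrightarrow(S^2,d\rho^2+\sin^2\rho\,d\phi^2)$ with $\varphi(r,\theta)=\left(\tfrac12\arccos\left(\sin^2\tfrac r2\right),2\theta\right)$ is proper biharmonic. In other words, the map $\varphi:(S^2,dr^2+\sin^2r\,d\theta^2)\longrightarrow(S^2,d\rho^2+\sin^2\rho\,d\phi^2)$ with $\varphi(r,\theta)=\left(\tfrac12\arccos\left(\sin^2\tfrac r2\right),2\theta\right)$ between the standard spheres is a proper $f$-biharmonic map (on $S^2\setminus\{N,S\}$) for this $f$.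
   Context: For a smooth map $\phi:(M,g)\to(N,h)$ of Riemannian manifolds, $\tau(\phi)=\mathrm{Tr}_g\nabla d\phi$ is the tension field and $\tau_2(\phi)=\mathrm{Trace}_g(\nabla^\phi\nabla^\phi-\nabla^\phi_{\nabla^M})\tau(\phi)-\mathrm{Trace}_g R^N(d\phi,\tau(\phi))d\phi$ is the bitension field, with $R^N(X,Y)Z=[\nabla^N_X,\nabla^N_Y]Z-\nabla^N_{[X,Y]}Z$. The map is harmonic if $\tau(\phi)=0$, biharmonic if $\tau_2(\phi)=0$, proper biharmonic if biharmonic but not harmonic. For a positive smooth function $f$ on $M$, it is $f$-biharmonic if $f\tau_2(\phi)+(\Delta f)\tau(\phi)+2\nabla^\phi_{\mathrm{grad} f}\tau(\phi)=0$, and proper $f$-biharmonic if it is $f$-biharmonic but neither harmonic nor biharmonic. On the unit sphere, $(r,\theta)$ (resp. $(\rho,\phi)$) are geodesic polar coordinates, $0<r<\pi$, $\theta\in\mathbb{R}/2\pi\mathbb{Z}$, and $N,S$ are the poles $r=0,\pi$. *)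

theory Defs
  imports "HOL-Analysis.Analysis"
begin

section \<open>Smooth functions on open subsets of coordinate space\<close>

definition pdiff :: "'n \<Rightarrow> (real^'n \<Rightarrow> 'b::real_normed_vector) \<Rightarrow> real^'n \<Rightarrow> 'b" where
  "pdiff i F x = frechet_derivative F (at x) (axis i 1)"

text \<open>The following is meant for open sets only.\<close>

primrec Ck_on :: "nat \<Rightarrow> (real^'n) set \<Rightarrow> (real^'n \<Rightarrow> 'b::real_normed_vector) \<Rightarrow> bool" where
  "Ck_on 0 U F \<longleftrightarrow> continuous_on U F"
| "Ck_on (Suc k) U F \<longleftrightarrow> F differentiable_on U \<and> (\<forall>i. Ck_on k U (pdiff i F))"

definition smooth_on :: "(real^'n) set \<Rightarrow> (real^'n \<Rightarrow> 'b::real_normed_vector) \<Rightarrow> bool" where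
  "smooth_on U F \<longleftrightarrow> (\<forall>k. Ck_on k U F)"


section \<open>Riemannian geometry in one coordinate system\<close>

text \<open>
  A metric in coordinates is a matrix-valued function \<open>G\<close>.
  \<open>christoffel G i j\<close> is the vector field \<open>\<nabla>\<^sub>\<partial>\<^sub>i \<partial>\<^sub>j\<close> of the Levi-Civita connection; its \<open>k\<close>-th
  component is the Christoffel symbol with upper index \<open>k\<close>.
\<close>

definition christoffel :: "(real^'n \<Rightarrow> real^'n^'n) \<Rightarrow> 'n \<Rightarrow> 'n \<Rightarrow> real^'n \<Rightarrow> real^'n" where
  "christoffel G i j x = (\<chi> k. (1/2) * (\<Sum>l\<in>UNIV. matrix_inv (G x) $ k $ l *
     (pdiff i (\<lambda>y. G y $ j $ l) x + pdiff j (\<lambda>y. G y $ i $ l) x - pdiff l (\<lambda>y. G y $ i $ j) x)))"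

definition cov :: "(real^'n \<Rightarrow> real^'n^'n) \<Rightarrow> (real^'n \<Rightarrow> real^'n) \<Rightarrow> (real^'n \<Rightarrow> real^'n)
    \<Rightarrow> real^'n \<Rightarrow> real^'n" where
  "cov G X Y x = frechet_derivative Y (at x) (X x)
     + (\<Sum>i\<in>UNIV. \<Sum>j\<in>UNIV. (X x $ i * Y x $ j) *\<^sub>R christoffel G i j x)"

definition lie_bracket :: "(real^'n \<Rightarrow> real^'n) \<Rightarrow> (real^'n \<Rightarrow> real^'n) \<Rightarrow> real^'n \<Rightarrow> real^'n" where
  "lie_bracket X Y x = frechet_derivative Y (at x) (X x) - frechet_derivative X (at x) (Y x)"

definition Rm :: "(real^'n \<Rightarrow> real^'n^'n) \<Rightarrow> (real^'n \<Rightarrow> real^'n) \<Rightarrow> (real^'n \<Rightarrow> real^'n)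
    \<Rightarrow> (real^'n \<Rightarrow> real^'n) \<Rightarrow> real^'n \<Rightarrow> real^'n" where
  "Rm G X Y Z x = cov G X (cov G Y Z) x - cov G Y (cov G X Z) x - cov G (lie_bracket X Y) Z x"

text \<open>
  The curvature is tensorial, so on tangent vectors at \<open>y\<close> it is evaluated on their extensions with
  constant components.
\<close>

definition curv :: "(real^'n \<Rightarrow> real^'n^'n) \<Rightarrow> real^'n \<Rightarrow> real^'n \<Rightarrow> real^'n \<Rightarrow> real^'n \<Rightarrow> real^'n" where
  "curv G y u v w = Rm G (\<lambda>_. u) (\<lambda>_. v) (\<lambda>_. w) y"

definition grad_coord :: "(real^'m \<Rightarrow> real^'m^'m) \<Rightarrow> (real^'m \<Rightarrow> real) \<Rightarrow> real^'m \<Rightarrow> real^'m" where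
  "grad_coord G u x = matrix_inv (G x) *v (\<chi> j. pdiff j u x)"

definition laplace_coord :: "(real^'m \<Rightarrow> real^'m^'m) \<Rightarrow> (real^'m \<Rightarrow> real) \<Rightarrow> real^'m \<Rightarrow> real" where
  "laplace_coord G u x = (\<Sum>i\<in>UNIV. \<Sum>j\<in>UNIV. matrix_inv (G x) $ i $ j *
     (pdiff i (pdiff j u) x - (\<Sum>k\<in>UNIV. christoffel G i j x $ k * pdiff k u x)))"

text \<open>
  For a map \<open>F\<close> into a coordinate domain with metric \<open>H\<close> and a vector field \<open>V\<close> along \<open>F\<close>,
  \<open>pull_cov H F i V\<close> is \<open>\<nabla>\<^sup>F V\<close> in the direction \<open>\<partial>\<^sub>i\<close>.
\<close>

definition pull_cov :: "(real^'n \<Rightarrow> real^'n^'n) \<Rightarrow> (real^'m \<Rightarrow> real^'n) \<Rightarrow> 'm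
    \<Rightarrow> (real^'m \<Rightarrow> real^'n) \<Rightarrow> real^'m \<Rightarrow> real^'n" where
  "pull_cov H F i V x = pdiff i V x
     + (\<Sum>b\<in>UNIV. \<Sum>c\<in>UNIV. (pdiff i F x $ b * V x $ c) *\<^sub>R christoffel H b c (F x))"

definition tension_coord :: "(real^'m \<Rightarrow> real^'m^'m) \<Rightarrow> (real^'n \<Rightarrow> real^'n^'n)
    \<Rightarrow> (real^'m \<Rightarrow> real^'n) \<Rightarrow> real^'m \<Rightarrow> real^'n" where
  "tension_coord G H F x = (\<Sum>i\<in>UNIV. \<Sum>j\<in>UNIV. matrix_inv (G x) $ i $ j *\<^sub>R
     (pull_cov H F i (pdiff j F) x - (\<Sum>k\<in>UNIV. christoffel G i j x $ k *\<^sub>R pdiff k F x)))"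

definition rough_laplace_coord :: "(real^'m \<Rightarrow> real^'m^'m) \<Rightarrow> (real^'n \<Rightarrow> real^'n^'n)
    \<Rightarrow> (real^'m \<Rightarrow> real^'n) \<Rightarrow> (real^'m \<Rightarrow> real^'n) \<Rightarrow> real^'m \<Rightarrow> real^'n" where
  "rough_laplace_coord G H F V x = (\<Sum>i\<in>UNIV. \<Sum>j\<in>UNIV. matrix_inv (G x) $ i $ j *\<^sub>R
     (pull_cov H F i (pull_cov H F j V) x - (\<Sum>k\<in>UNIV. christoffel G i j x $ k *\<^sub>R pull_cov H F k V x)))"

definition bitension_coord :: "(real^'m \<Rightarrow> real^'m^'m) \<Rightarrow> (real^'n \<Rightarrow> real^'n^'n)
    \<Rightarrow> (real^'m \<Rightarrow> real^'n) \<Rightarrow> real^'m \<Rightarrow> real^'n" where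
  "bitension_coord G H F x = rough_laplace_coord G H F (tension_coord G H F) x
     - (\<Sum>i\<in>UNIV. \<Sum>j\<in>UNIV. matrix_inv (G x) $ i $ j *\<^sub>R
          curv H (F x) (pdiff i F x) (tension_coord G H F x) (pdiff j F x))"

definition grad_cov_tension_coord :: "(real^'m \<Rightarrow> real) \<Rightarrow> (real^'m \<Rightarrow> real^'m^'m)
    \<Rightarrow> (real^'n \<Rightarrow> real^'n^'n) \<Rightarrow> (real^'m \<Rightarrow> real^'n) \<Rightarrow> real^'m \<Rightarrow> real^'n" where
  "grad_cov_tension_coord u G H F x =
     (\<Sum>i\<in>UNIV. grad_coord G u x $ i *\<^sub>R pull_cov H F i (tension_coord G H F) x)"


section \<open>Riemannian manifolds\<close>

text \<open>
  Manifolds are submanifolds of a Euclidean space \<open>'a\<close>, so that tangent vectors are vectors of \<open>'a\<close>.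
  The Riemannian metric is arbitrary (not necessarily the induced one): \<open>rmetric M p\<close> is a bilinear
  form on \<open>'a\<close>, of which only the restriction to the tangent space at \<open>p\<close> matters.
  Every point \<open>p\<close> comes with a preferred local parametrization \<open>(U, \<psi>)\<close> around it, and the geometric
  objects at \<open>p\<close> are computed in it. These objects are tensorial, so a different choice of
  parametrizations would give the same vectors.
\<close>

record ('a, 'n) rmanifold =
  pts :: "'a set"
  chart_at :: "'a \<Rightarrow> (real^'n) set \<times> (real^'n \<Rightarrow> 'a)"
  rmetric :: "'a \<Rightarrow> 'a \<Rightarrow> 'a \<Rightarrow> real"

abbreviation dom_at :: "('a, 'n::finite) rmanifold \<Rightarrow> 'a \<Rightarrow> (real^'n) set" where
  "dom_at M p \<equiv> fst (chart_at M p)"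

abbreviation param_at :: "('a, 'n::finite) rmanifold \<Rightarrow> 'a \<Rightarrow> real^'n \<Rightarrow> 'a" where
  "param_at M p \<equiv> snd (chart_at M p)"

definition coords_at :: "('a, 'n::finite) rmanifold \<Rightarrow> 'a \<Rightarrow> 'a \<Rightarrow> real^'n" where
  "coords_at M p = inv_into (dom_at M p) (param_at M p)"

definition metric_at :: "('a::euclidean_space, 'n::finite) rmanifold \<Rightarrow> 'a \<Rightarrow> real^'n \<Rightarrow> real^'n^'n" where
  "metric_at M p x = (\<chi> i j. rmetric M (param_at M p x)
     (pdiff i (param_at M p) x) (pdiff j (param_at M p) x))"

definition local_param ::
    "'a::euclidean_space set \<Rightarrow> (real^'n) set \<Rightarrow> (real^'n \<Rightarrow> 'a) \<Rightarrow> bool" where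
  "local_param S U \<psi> \<longleftrightarrow> open U \<and> smooth_on U \<psi> \<and> inj_on \<psi> U
     \<and> (\<forall>x\<in>U. inj (frechet_derivative \<psi> (at x)))
     \<and> openin (top_of_set S) (\<psi> ` U) \<and> continuous_on (\<psi> ` U) (inv_into U \<psi>)"

definition riemannian_manifold :: "('a::euclidean_space, 'n::finite) rmanifold \<Rightarrow> bool" where
  "riemannian_manifold M \<longleftrightarrow> (\<forall>p\<in>pts M.
     local_param (pts M) (dom_at M p) (param_at M p) \<and> p \<in> param_at M p ` dom_at M p
     \<and> bilinear (rmetric M p) \<and> (\<forall>v w. rmetric M p v w = rmetric M p w v)
     \<and> (\<forall>v \<in> range (frechet_derivative (param_at M p) (at (coords_at M p p))).
           v \<noteq> 0 \<longrightarrow> rmetric M p v v > 0)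
     \<and> smooth_on (dom_at M p) (metric_at M p))"

definition smooth_fun :: "('a, 'n::finite) rmanifold \<Rightarrow> ('a \<Rightarrow> 'b::real_normed_vector) \<Rightarrow> bool" where
  "smooth_fun M u \<longleftrightarrow> (\<forall>p\<in>pts M. smooth_on (dom_at M p) (u \<circ> param_at M p))"

text \<open>
  A map into a submanifold is smooth iff it is smooth as a map into the ambient space.
\<close>

definition smooth_map :: "('a::euclidean_space, 'm::finite) rmanifold \<Rightarrow> ('b::euclidean_space, 'n::finite) rmanifold
    \<Rightarrow> ('a \<Rightarrow> 'b) \<Rightarrow> bool" where
  "smooth_map M N \<phi> \<longleftrightarrow> riemannian_manifold M \<and> riemannian_manifold N
     \<and> \<phi> ` pts M \<subseteq> pts N \<and> smooth_fun M \<phi>"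

definition coord_map :: "('a, 'm::finite) rmanifold \<Rightarrow> ('b, 'n::finite) rmanifold
    \<Rightarrow> ('a \<Rightarrow> 'b) \<Rightarrow> 'a \<Rightarrow> real^'m \<Rightarrow> real^'n" where
  "coord_map M N \<phi> p = coords_at N (\<phi> p) \<circ> \<phi> \<circ> param_at M p"

definition tangent_vec :: "('a::euclidean_space, 'n::finite) rmanifold \<Rightarrow> 'a \<Rightarrow> real^'n \<Rightarrow> 'a" where
  "tangent_vec N q v = frechet_derivative (param_at N q) (at (coords_at N q q)) v"

definition tension :: "('a::euclidean_space, 'm::finite) rmanifold \<Rightarrow> ('b::euclidean_space, 'n::finite) rmanifold
    \<Rightarrow> ('a \<Rightarrow> 'b) \<Rightarrow> 'a \<Rightarrow> 'b" where
  "tension M N \<phi> p = tangent_vec N (\<phi> p)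
     (tension_coord (metric_at M p) (metric_at N (\<phi> p)) (coord_map M N \<phi> p) (coords_at M p p))"

definition bitension :: "('a::euclidean_space, 'm::finite) rmanifold \<Rightarrow> ('b::euclidean_space, 'n::finite) rmanifold
    \<Rightarrow> ('a \<Rightarrow> 'b) \<Rightarrow> 'a \<Rightarrow> 'b" where
  "bitension M N \<phi> p = tangent_vec N (\<phi> p)
     (bitension_coord (metric_at M p) (metric_at N (\<phi> p)) (coord_map M N \<phi> p) (coords_at M p p))"

definition grad_cov_tension :: "('a \<Rightarrow> real) \<Rightarrow> ('a::euclidean_space, 'm::finite) rmanifold
    \<Rightarrow> ('b::euclidean_space, 'n::finite) rmanifold \<Rightarrow> ('a \<Rightarrow> 'b) \<Rightarrow> 'a \<Rightarrow> 'b" where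
  "grad_cov_tension u M N \<phi> p = tangent_vec N (\<phi> p)
     (grad_cov_tension_coord (u \<circ> param_at M p) (metric_at M p) (metric_at N (\<phi> p))
        (coord_map M N \<phi> p) (coords_at M p p))"

definition laplace :: "('a::euclidean_space, 'm::finite) rmanifold \<Rightarrow> ('a \<Rightarrow> real) \<Rightarrow> 'a \<Rightarrow> real" where
  "laplace M u p = laplace_coord (metric_at M p) (u \<circ> param_at M p) (coords_at M p p)"


section \<open>Harmonic, biharmonic and f-biharmonic maps\<close>

definition harmonic :: "('a::euclidean_space, 'm::finite) rmanifold \<Rightarrow> ('b::euclidean_space, 'n::finite) rmanifold
    \<Rightarrow> ('a \<Rightarrow> 'b) \<Rightarrow> bool" where
  "harmonic M N \<phi> \<longleftrightarrow> smooth_map M N \<phi> \<and> (\<forall>p\<in>pts M. tension M N \<phi> p = 0)"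

definition biharmonic :: "('a::euclidean_space, 'm::finite) rmanifold \<Rightarrow> ('b::euclidean_space, 'n::finite) rmanifold
    \<Rightarrow> ('a \<Rightarrow> 'b) \<Rightarrow> bool" where
  "biharmonic M N \<phi> \<longleftrightarrow> smooth_map M N \<phi> \<and> (\<forall>p\<in>pts M. bitension M N \<phi> p = 0)"

definition proper_biharmonic :: "('a::euclidean_space, 'm::finite) rmanifold
    \<Rightarrow> ('b::euclidean_space, 'n::finite) rmanifold \<Rightarrow> ('a \<Rightarrow> 'b) \<Rightarrow> bool" where
  "proper_biharmonic M N \<phi> \<longleftrightarrow> biharmonic M N \<phi> \<and> \<not> harmonic M N \<phi>"

definition f_biharmonic :: "('a \<Rightarrow> real) \<Rightarrow> ('a::euclidean_space, 'm::finite) rmanifold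
    \<Rightarrow> ('b::euclidean_space, 'n::finite) rmanifold \<Rightarrow> ('a \<Rightarrow> 'b) \<Rightarrow> bool" where
  "f_biharmonic f M N \<phi> \<longleftrightarrow> smooth_map M N \<phi> \<and> smooth_fun M f \<and> (\<forall>p\<in>pts M. f p > 0)
     \<and> (\<forall>p\<in>pts M. f p *\<^sub>R bitension M N \<phi> p + laplace M f p *\<^sub>R tension M N \<phi> p
            + 2 *\<^sub>R grad_cov_tension f M N \<phi> p = 0)"

definition proper_f_biharmonic :: "('a \<Rightarrow> real) \<Rightarrow> ('a::euclidean_space, 'm::finite) rmanifold
    \<Rightarrow> ('b::euclidean_space, 'n::finite) rmanifold \<Rightarrow> ('a \<Rightarrow> 'b) \<Rightarrow> bool" where
  "proper_f_biharmonic f M N \<phi> \<longleftrightarrow>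
     f_biharmonic f M N \<phi> \<and> \<not> harmonic M N \<phi> \<and> \<not> biharmonic M N \<phi>"


section \<open>The unit sphere in geodesic polar coordinates\<close>

definition sph :: "real \<Rightarrow> real \<Rightarrow> real^3" where
  "sph r \<theta> = vector [sin r * cos \<theta>, sin r * sin \<theta>, cos r]"

definition polar_radius :: "real^3 \<Rightarrow> real" where
  "polar_radius p = arccos (p $ 3)"

definition north :: "real^3" where "north = axis 3 1"
definition south :: "real^3" where "south = - axis 3 1"

definition polar_dom :: "real \<Rightarrow> (real^2) set" where
  "polar_dom c = {x. 0 < x $ 1 \<and> x $ 1 < pi \<and> c - pi < x $ 2 \<and> x $ 2 < c + pi}"

text \<open>
  Away from the poles, geodesic polar coordinates with an angle window centred at the angle of the
  given point; at the poles, geodesic polar coordinates centred at the first unit vector.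
\<close>

definition sphere_chart :: "real^3 \<Rightarrow> (real^2) set \<times> (real^2 \<Rightarrow> real^3)" where
  "sphere_chart p =
     (if p \<in> {north, south}
      then (polar_dom 0, \<lambda>x. let q = sph (x $ 1) (x $ 2) in vector [q $ 3, q $ 1, q $ 2])
      else (polar_dom (Arg (Complex (p $ 1) (p $ 2))), \<lambda>x. sph (x $ 1) (x $ 2)))"

definition round_metric :: "real^3 \<Rightarrow> real^3 \<Rightarrow> real^3 \<Rightarrow> real" where
  "round_metric p v w = v \<bullet> w"

definition round_sphere :: "(real^3, 2) rmanifold" where
  "round_sphere = \<lparr>pts = sphere 0 1, chart_at = sphere_chart, rmetric = round_metric\<rparr>"

definition punctured_sphere :: "(real^3 \<Rightarrow> real^3 \<Rightarrow> real^3 \<Rightarrow> real) \<Rightarrow> (real^3, 2) rmanifold" where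
  "punctured_sphere g =
     \<lparr>pts = sphere 0 1 - {north, south}, chart_at = sphere_chart, rmetric = g\<rparr>"


subsection \<open>Consistency of the conventions\<close>

lemma polar_radius_sph: "0 < r \<Longrightarrow> r < pi \<Longrightarrow> polar_radius (sph r \<theta>) = r"
  by (simp add: polar_radius_def sph_def arccos_cos)

lemma sph_in_punctured:
  assumes "0 < r" "r < pi"
  shows "sph r \<theta> \<in> sphere 0 1 - {north, south}"
proof -
  have s: "sin r > 0" using assms by (rule sin_gt_zero)
  have "(norm (sph r \<theta>))\<^sup>2 = (sin r)\<^sup>2 * ((cos \<theta>)\<^sup>2 + (sin \<theta>)\<^sup>2) + (cos r)\<^sup>2"
    unfolding power2_norm_eq_inner
    by (simp add: sph_def inner_vec_def sum_3 algebra_simps del: sin_cos_squared_add2)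
       (simp add: power2_eq_square algebra_simps)
  then have "(norm (sph r \<theta>))\<^sup>2 = 1\<^sup>2" by simp
  then have "norm (sph r \<theta>) = 1" by (rule power2_eq_imp_eq) simp_all
  moreover have False if "sph r \<theta> \<in> {north, south}"
  proof -
    have "sin r * cos \<theta> = 0" "sin r * sin \<theta> = 0"
      using that by (auto simp: sph_def north_def south_def vec_eq_iff forall_3 axis_def)
    with s have "cos \<theta> = 0" "sin \<theta> = 0" by auto
    then show False using sin_cos_squared_add[of \<theta>] by simp
  qed
  ultimately show ?thesis by auto
qed

lemma sph_eq_iff:
  assumes "0 < r" "r < pi" "0 < r'" "r' < pi"
  shows "sph r \<theta> = sph r' \<theta>' \<longleftrightarrow> r = r' \<and> (\<exists>k::int. \<theta> = \<theta>' + 2 * pi * k)"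
proof
  assume eq: "sph r \<theta> = sph r' \<theta>'"
  then have r: "r = r'" using polar_radius_sph assms by metis
  moreover have "sin r' > 0" using assms(3,4) by (rule sin_gt_zero)
  ultimately have "sin \<theta> = sin \<theta>' \<and> cos \<theta> = cos \<theta>'"
    using eq by (auto simp: sph_def vec_eq_iff forall_3)
  with r show "r = r' \<and> (\<exists>k::int. \<theta> = \<theta>' + 2 * pi * k)"
    by (simp add: sin_cos_eq_iff)
next
  assume R: "r = r' \<and> (\<exists>k::int. \<theta> = \<theta>' + 2 * pi * k)"
  then have "sin \<theta> = sin \<theta>' \<and> cos \<theta> = cos \<theta>'" by (simp only: sin_cos_eq_iff)
  with R show "sph r \<theta> = sph r' \<theta>'" by (simp add: sph_def)
qed

lemma sph_surj:
  assumes "p \<in> sphere 0 1 - {north, south}"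
  shows "\<exists>r \<theta>. 0 < r \<and> r < pi \<and> p = sph r \<theta>"
proof -
  have n: "(p $ 1)\<^sup>2 + (p $ 2)\<^sup>2 + (p $ 3)\<^sup>2 = 1"
  proof -
    have "p \<bullet> p = 1" using assms by (simp add: dot_square_norm)
    then show ?thesis by (simp add: inner_vec_def sum_3 power2_eq_square)
  qed
  have ne: "\<bar>p $ 3\<bar> \<noteq> 1"
  proof
    assume a: "\<bar>p $ 3\<bar> = 1"
    then have "(p $ 3)\<^sup>2 = 1" by (simp add: power2_eq_1_iff abs_if split: if_splits)
    with n have "p $ 1 = 0" "p $ 2 = 0" by (simp_all add: sum_power2_eq_zero_iff)
    with a have "p = north \<or> p = south"
      by (auto simp: north_def south_def vec_eq_iff forall_3 axis_def abs_if split: if_splits)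
    with assms show False by simp
  qed
  have "(p $ 3)\<^sup>2 \<le> 1" using n zero_le_power2[of "p $ 1"] zero_le_power2[of "p $ 2"] by linarith
  then have lt: "\<bar>p $ 3\<bar> < 1" using ne by (simp add: abs_square_le_1)
  define r where "r = arccos (p $ 3)"
  have r: "0 < r" "r < pi" "cos r = p $ 3"
    using lt arccos_lt_bounded[of "p $ 3"] by (auto simp: r_def abs_less_iff)
  have s: "sin r > 0" using r by (intro sin_gt_zero)
  have "(p $ 1)\<^sup>2 + (p $ 2)\<^sup>2 = (sin r)\<^sup>2" using n r(3) by (simp add: sin_squared_eq)
  then have "(p $ 1 / sin r)\<^sup>2 + (p $ 2 / sin r)\<^sup>2 = 1"
    using s by (simp add: power_divide add_divide_distrib[symmetric])
  then obtain \<theta> where "p $ 1 / sin r = cos \<theta>" "p $ 2 / sin r = sin \<theta>"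
    by (rule sincos_total_2pi)
  then have "p = sph r \<theta>"
    using s r(3) by (simp add: sph_def vec_eq_iff forall_3 field_simps)
  with r show ?thesis by blast
qed

text \<open>The Euclidean inner product is \<open>dr\<^sup>2 + sin\<^sup>2 r d\<theta>\<^sup>2\<close> in polar coordinates.\<close>

lemma has_derivative_sph:
  fixes x :: "real^2"
  shows "((\<lambda>x. sph (x $ 1) (x $ 2)) has_derivative
     (\<lambda>h. vector [h $ 1 * cos (x $ 1) * cos (x $ 2) - h $ 2 * sin (x $ 1) * sin (x $ 2),
                  h $ 1 * cos (x $ 1) * sin (x $ 2) + h $ 2 * sin (x $ 1) * cos (x $ 2),
                  - h $ 1 * sin (x $ 1)])) (at x)"
proof -
  have v: "vector [a, b, c] = a *\<^sub>R axis 1 1 + b *\<^sub>R axis 2 1 + c *\<^sub>R (axis 3 1 :: real^3)" for a b c :: real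
    by (simp add: vec_eq_iff forall_3 axis_def)
  have d: "((\<lambda>x::real^2. x $ i) has_derivative (\<lambda>h. h $ i)) (at x)" for i
    by (intro bounded_linear_imp_has_derivative bounded_linear_vec_nth)
  show ?thesis
    unfolding sph_def v
    by (rule derivative_eq_intros d refl)+ (auto simp: algebra_simps fun_eq_iff)
qed

lemma round_metric_polar:
  fixes x :: "real^2"
  shows "round_metric q (pdiff i (\<lambda>x. sph (x $ 1) (x $ 2)) x) (pdiff j (\<lambda>x. sph (x $ 1) (x $ 2)) x)
     = (if i \<noteq> j then 0 else if i = 1 then 1 else (sin (x $ 1))\<^sup>2)"
proof -
  have D: "pdiff i (\<lambda>x. sph (x $ 1) (x $ 2)) x =
      vector [axis i 1 $ 1 * cos (x $ 1) * cos (x $ 2) - axis i 1 $ 2 * sin (x $ 1) * sin (x $ 2),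
              axis i 1 $ 1 * cos (x $ 1) * sin (x $ 2) + axis i 1 $ 2 * sin (x $ 1) * cos (x $ 2),
              - axis i 1 $ 1 * sin (x $ 1)]" for i :: 2
    unfolding pdiff_def frechet_derivative_at[OF has_derivative_sph, symmetric] by simp
  have pyth: "(a * c) * (a * c) + (a * s) * (a * s) = a\<^sup>2" if "s\<^sup>2 + c\<^sup>2 = 1" for a c s :: real
  proof -
    have "(a * c) * (a * c) + (a * s) * (a * s) = a\<^sup>2 * (s\<^sup>2 + c\<^sup>2)"
      by (simp add: power2_eq_square algebra_simps)
    with that show ?thesis by simp
  qed
  have rr: "cos (x $ 1) * cos (x $ 2) * (cos (x $ 1) * cos (x $ 2)) +
     cos (x $ 1) * sin (x $ 2) * (cos (x $ 1) * sin (x $ 2)) + sin (x $ 1) * sin (x $ 1) = 1"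
    using pyth[of "sin (x $ 2)" "cos (x $ 2)" "cos (x $ 1)", OF sin_cos_squared_add]
      sin_cos_squared_add[of "x $ 1"]
    by (simp add: power2_eq_square)
  have tt: "sin (x $ 1) * sin (x $ 2) * (sin (x $ 1) * sin (x $ 2)) +
     sin (x $ 1) * cos (x $ 2) * (sin (x $ 1) * cos (x $ 2)) = (sin (x $ 1))\<^sup>2"
    using pyth[of "cos (x $ 2)" "sin (x $ 2)" "sin (x $ 1)"] by simp
  consider "i = 1" "j = 1" | "i = 1" "j = 2" | "i = 2" "j = 1" | "i = 2" "j = 2"
    using exhaust_2 by metis
  then show ?thesis
  proof cases
    case 1
    then show ?thesis using rr
      by (simp add: D round_metric_def inner_vec_def sum_3 axis_def)
  next
    case 4
    then show ?thesis using tt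
      by (simp add: D round_metric_def inner_vec_def sum_3 axis_def)
  qed (simp_all add: D round_metric_def inner_vec_def sum_3 axis_def)
qed

text \<open>
  A map given in polar coordinates is well defined on the sphere without the poles if it respects the
  period of the angle.
\<close>

lemma polar_map_exists:
  "\<exists>\<phi>. \<forall>r \<theta>. 0 < r \<longrightarrow> r < pi \<longrightarrow> \<phi> (sph r \<theta>) = sph (R r) (2 * \<theta>)"
proof -
  define \<phi> where "\<phi> p = sph (R (polar_radius p)) (2 * (SOME \<theta>. p = sph (polar_radius p) \<theta>))" for p
  have "\<phi> (sph r \<theta>) = sph (R r) (2 * \<theta>)" if r: "0 < r" "r < pi" for r \<theta>
  proof -
    have "sph r \<theta> = sph r (SOME \<theta>'. sph r \<theta> = sph r \<theta>')" by (rule someI) (rule refl)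
    then obtain k :: int where k: "\<theta> = (SOME \<theta>'. sph r \<theta> = sph r \<theta>') + 2 * pi * k"
      using r by (subst (asm) sph_eq_iff) auto
    define \<theta>' where "\<theta>' = (SOME \<theta>'. sph r \<theta> = sph r \<theta>')"
    have "\<exists>n::int. 2 * \<theta> = 2 * \<theta>' + 2 * pi * n"
      using k by (intro exI[of _ "2 * k"]) (simp add: \<theta>'_def)
    then have "sin (2 * \<theta>) = sin (2 * \<theta>') \<and> cos (2 * \<theta>) = cos (2 * \<theta>')"
      by (simp only: sin_cos_eq_iff)
    then have "sph (R r) (2 * \<theta>) = sph (R r) (2 * \<theta>')" by (simp add: sph_def)
    then show ?thesis using r by (simp add: \<phi>_def polar_radius_sph \<theta>'_def)
  qed
  then show ?thesis by blast
qed

end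

theory Submission
  imports Defs
begin

text \<open>
  Write \<open>R r = arccos (sin\<^sup>2 (r/2)) / 2\<close>, so that the map is \<open>(r, \<theta>) \<mapsto> (R r, 2\<theta>)\<close>. It turns the
  rotation by an angle into the rotation by twice the angle, and it maps meridians to meridians. Hence its tension
  and bitension fields are of the form \<open>u(r) \<partial>\<^sub>\<rho>\<close>, and every equation between such fields is an ordinary differential equation for \<open>u\<close>. With respect to a metric \<open>w(r) (dr\<^sup>2 + sin\<^sup>2 r d\<theta>\<^sup>2)\<close> the tension
  field has profile
    \<open>(R'' + cot r R' - 4 sin R cos R / sin\<^sup>2 r) / w\<close>,
  and the Jacobi operator (rough Laplacian minus curvature term), which yields the bitension field, sends the
  profile \<open>u\<close> to
    \<open>(u'' + cot r u' - 4 cos (2R) / sin\<^sup>2 r u) / w\<close>.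
  The derivatives of \<open>w\<close> cancel in both because the domain has dimension two.

  Let \<open>T\<close> be the tension profile for \<open>w = 1\<close>. For \<open>w = 1/f\<close> the tension profile is \<open>f T\<close>. Multiplying \<open>T\<close> by
  \<open>f\<close> in the round metric instead, the product rule turns the left-hand side of the f-biharmonic equation into
  the round Jacobi operator applied to \<open>f T\<close>. So both claims say that \<open>f T\<close> solves the Jacobi equation.
  Since \<open>cos (2R) = sin\<^sup>2 (r/2)\<close>, this equation is
    \<open>u'' + cot r u' = 2 u / (1 + cos r)\<close>,
  which has the elementary solution \<open>u = - 4 / (1 + cos r)\<close>, and \<open>f\<close> is exactly the quotient \<open>u / T\<close>
  (lemmas \<open>jacobi_equation\<close> and \<open>tension_eq_jacobi_over_weight\<close>). This \<open>u\<close> has no zero, so the map is not harmonic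
  for either metric. It is not biharmonic for the round metric, since the Jacobi operator does not annihilate \<open>T\<close>
  itself on the equator \<open>r = \<pi>/2\<close> (lemma \<open>tension_not_jacobi\<close>).

  What remains is to connect this computation to maps between manifolds with charts: the charts of the sphere
  are smooth parametrizations (lemma \<open>local_param_sphere\<close>), the map is smooth because \<open>cos R\<close> and \<open>sin R\<close> are
  square roots of positive polynomials in \<open>cos r\<close>, and in suitable charts around a point and its image the map has
  the form \<open>(r, \<theta>) \<mapsto> (R r, 2\<theta> + d)\<close> (lemma \<open>rotational_map_in_charts\<close>).
\<close>



section \<open>Calculus of smooth functions on coordinate space\<close>

lemma pdiff_eq: "(F has_derivative D) (at x) \<Longrightarrow> pdiff i F x = D (axis i 1)"
  unfolding pdiff_def by (simp add: frechet_derivative_at[symmetric])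

text \<open>
  The derivative is a choice among the derivatives at the point, and two functions
  with the same germ have the same ones. This allows coordinate expressions known only locally to be differentiated.
\<close>

lemma frechet_derivative_cong_open:
  assumes "open U" "x \<in> U" "\<And>y. y \<in> U \<Longrightarrow> F y = F' y"
  shows "frechet_derivative F (at x) = frechet_derivative F' (at x)"
proof -
  have "(F has_derivative D) (at x) \<longleftrightarrow> (F' has_derivative D) (at x)" for D
    using has_derivative_transform_within_open[of F D x UNIV U F', OF _ assms]
      has_derivative_transform_within_open[of F' D x UNIV U F, OF _ assms(1,2) assms(3)[symmetric]]
    by blast
  then show ?thesis by (simp add: frechet_derivative_def)
qed

lemma pdiff_cong_open:
  assumes "open U" "x \<in> U" "\<And>y. y \<in> U \<Longrightarrow> F y = F' y"
  shows "pdiff i F x = pdiff i F' x"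
  unfolding pdiff_def by (simp add: frechet_derivative_cong_open[OF assms])

lemma Ck_on_cong:
  assumes "open U" "Ck_on k U F" "\<And>y. y \<in> U \<Longrightarrow> F y = F' y"
  shows "Ck_on k U F'"
  using assms(2,3)
proof (induction k arbitrary: F F')
  case 0
  then show ?case using continuous_on_cong[of U U F F'] by (metis Ck_on.simps(1))
next
  case (Suc k)
  have "F' differentiable_on U"
    unfolding differentiable_on_def
  proof
    fix x assume x: "x \<in> U"
    with Suc.prems(1) have "F differentiable (at x within U)" by (simp add: differentiable_on_def)
    then show "F' differentiable (at x within U)"
      by (rule differentiable_transform_within[OF _ zero_less_one x]) (rule Suc.prems(2))
  qed
  moreover have "Ck_on k U (pdiff i F')" for i
  proof (rule Suc.IH)
    show "Ck_on k U (pdiff i F)" using Suc.prems(1) by simp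
    show "pdiff i F y = pdiff i F' y" if "y \<in> U" for y
      using assms(1) that Suc.prems(2) by (rule pdiff_cong_open)
  qed
  ultimately show ?case by (simp add: Ck_on.simps(2))
qed

lemma smooth_on_cong:
  assumes "open U" "smooth_on U F" "\<And>y. y \<in> U \<Longrightarrow> F y = F' y"
  shows "smooth_on U F'"
  unfolding smooth_on_def
proof
  fix k
  from assms(2) have "Ck_on k U F" by (simp add: smooth_on_def)
  with assms(1) show "Ck_on k U F'" by (rule Ck_on_cong) (rule assms(3))
qed

text \<open>
  As a rewrite rule the recursion loops with induction hypotheses that relate consecutive orders.
\<close>

declare Ck_on.simps(2) [simp del]
lemmas Ck_on_Suc = Ck_on.simps(2)

lemma Ck_on_SucI: "F differentiable_on U \<Longrightarrow> (\<And>i. Ck_on k U (pdiff i F)) \<Longrightarrow> Ck_on (Suc k) U F"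
  by (simp add: Ck_on_Suc)

lemma Ck_on_SucD:
  assumes "Ck_on (Suc k) U F"
  shows "F differentiable_on U" "Ck_on k U (pdiff i F)"
  using assms by (simp_all add: Ck_on_Suc)

lemma Ck_on_differentiable:
  assumes "Ck_on (Suc k) U F" "open U" "x \<in> U"
  shows "F differentiable (at x)"
  using Ck_on_SucD(1)[OF assms(1)] assms(2,3) by (simp add: differentiable_on_eq_differentiable_at)

lemma Ck_on_mono_Suc: "Ck_on (Suc k) U F \<Longrightarrow> Ck_on k U F"
proof (induction k arbitrary: F)
  case 0
  then show ?case by (simp add: Ck_on_Suc differentiable_imp_continuous_on)
next
  case (Suc k)
  show ?case
    by (rule Ck_on_SucI[OF Ck_on_SucD(1)[OF Suc.prems] Suc.IH[OF Ck_on_SucD(2)[OF Suc.prems]]])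
qed

lemma pdiff_const: "pdiff i (\<lambda>_. c) = (\<lambda>_. 0)"
  by (rule ext) (simp only: pdiff_eq[OF has_derivative_const])

lemma pdiff_nth: "pdiff j (\<lambda>x. x $ i) = (\<lambda>_. axis j 1 $ i :: real)"
  by (rule ext) (rule pdiff_eq, intro bounded_linear_imp_has_derivative bounded_linear_vec_nth)

lemma Ck_on_const: "Ck_on k (U :: (real^'n) set) (\<lambda>_. c)"
proof (induction k arbitrary: c)
  case (Suc k)
  show ?case by (rule Ck_on_SucI) (simp_all only: pdiff_const Suc.IH differentiable_on_const)
qed simp

lemma Ck_on_nth: "Ck_on k (U :: (real^'n) set) (\<lambda>x. x $ i :: real)"
proof (cases k)
  case (Suc m)
  have "(\<lambda>x::real^'n. x $ i) differentiable_on U"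
    by (intro bounded_linear_imp_differentiable_on bounded_linear_vec_nth)
  then show ?thesis
    unfolding Suc pdiff_nth by (intro Ck_on_SucI) (simp_all add: pdiff_nth Ck_on_const)
next
  case 0
  have "continuous_on U (\<lambda>x::real^'n. x $ i)" by (intro continuous_intros)
  with 0 show ?thesis by simp
qed

lemma Ck_on_add:
  assumes "open U"
  shows "Ck_on k U F \<Longrightarrow> Ck_on k U F' \<Longrightarrow> Ck_on k U (\<lambda>x. F x + F' x)"
proof (induction k arbitrary: F F')
  case (Suc k)
  have eq: "pdiff i F x + pdiff i F' x = pdiff i (\<lambda>x. F x + F' x) x" if "x \<in> U" for i x
  proof -
    have "F differentiable (at x)" "F' differentiable (at x)"
      by (rule Ck_on_differentiable[OF Suc.prems(1) assms that])
        (rule Ck_on_differentiable[OF Suc.prems(2) assms that])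
    then show ?thesis
      unfolding frechet_derivative_works pdiff_def[of i F] pdiff_def[of i F']
      by (rule pdiff_eq[OF has_derivative_add, symmetric])
  qed
  have "Ck_on k U (\<lambda>x. pdiff i F x + pdiff i F' x)" for i
    by (rule Suc.IH[OF Ck_on_SucD(2)[OF Suc.prems(1)] Ck_on_SucD(2)[OF Suc.prems(2)]])
  then have "Ck_on k U (pdiff i (\<lambda>x. F x + F' x))" for i
    using eq by (rule Ck_on_cong[OF assms])
  with Suc.prems show ?case by (auto simp: Ck_on_Suc)
qed (auto intro: continuous_intros)

lemma Ck_on_mult:
  fixes F F' :: "real^'n \<Rightarrow> real"
  assumes "open U"
  shows "Ck_on k U F \<Longrightarrow> Ck_on k U F' \<Longrightarrow> Ck_on k U (\<lambda>x. F x * F' x)"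
proof (induction k arbitrary: F F')
  case (Suc k)
  have eq: "F x * pdiff i F' x + pdiff i F x * F' x = pdiff i (\<lambda>x. F x * F' x) x" if "x \<in> U" for i x
  proof -
    have "F differentiable (at x)" "F' differentiable (at x)"
      by (rule Ck_on_differentiable[OF Suc.prems(1) assms that])
        (rule Ck_on_differentiable[OF Suc.prems(2) assms that])
    then show ?thesis
      unfolding frechet_derivative_works pdiff_def[of i F] pdiff_def[of i F']
      by (rule pdiff_eq[OF has_derivative_mult, symmetric])
  qed
  have "Ck_on k U (\<lambda>x. F x * pdiff i F' x + pdiff i F x * F' x)" for i
    by (intro Ck_on_add[OF assms] Suc.IH
        Ck_on_mono_Suc[OF Suc.prems(1)] Ck_on_SucD(2)[OF Suc.prems(2)]
        Ck_on_mono_Suc[OF Suc.prems(2)] Ck_on_SucD(2)[OF Suc.prems(1)])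
  then have "Ck_on k U (pdiff i (\<lambda>x. F x * F' x))" for i
    using eq by (rule Ck_on_cong[OF assms])
  with Suc.prems show ?case by (auto simp: Ck_on_Suc)
qed (auto intro: continuous_intros)

text \<open>
  A function of one variable together with all its derivatives. Composition with such a function is proved smooth
  for all members of the sequence at once, because differentiating \<open>D n \<circ> F\<close> produces \<open>D (Suc n) \<circ> F\<close>.
\<close>

definition derivative_tower :: "(nat \<Rightarrow> real \<Rightarrow> real) \<Rightarrow> real set \<Rightarrow> bool" where
  "derivative_tower D I \<longleftrightarrow> (\<forall>n. \<forall>t\<in>I. (D n has_real_derivative D (Suc n) t) (at t))"

lemma Ck_on_compose:
  fixes F :: "real^'n \<Rightarrow> real"
  assumes "open U" and D: "derivative_tower D I" and I: "\<And>x. x \<in> U \<Longrightarrow> F x \<in> I"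
  shows "Ck_on k U F \<Longrightarrow> Ck_on k U (\<lambda>x. D n (F x))"
proof (induction k arbitrary: n)
  case 0
  have "continuous_on I (D n)"
  proof (rule DERIV_continuous_on)
    fix t assume "t \<in> I"
    with D show "(D n has_real_derivative D (Suc n) t) (at t within I)"
      unfolding derivative_tower_def by (blast intro: has_field_derivative_at_within)
  qed
  moreover have "continuous_on U F" using 0 by simp
  ultimately show ?case unfolding Ck_on.simps by (rule continuous_on_compose2) (use I in blast)
next
  case (Suc k)
  have d: "((\<lambda>x. D n (F x)) has_derivative (\<lambda>h. D (Suc n) (F x) * frechet_derivative F (at x) h)) (at x)"
    if "x \<in> U" for x
  proof -
    have "(F has_derivative frechet_derivative F (at x)) (at x)"
      using Ck_on_differentiable[OF Suc.prems assms(1) that] unfolding frechet_derivative_works .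
    then show ?thesis
    proof (rule has_derivative_compose)
      show "(D n has_derivative (*) (D (Suc n) (F x))) (at (F x))"
        using D I[OF that] unfolding derivative_tower_def has_field_derivative_def by blast
    qed
  qed
  have "Ck_on k U (\<lambda>x. D (Suc n) (F x) * pdiff i F x)" for i
    by (intro Ck_on_mult[OF assms(1)] Suc.IH Ck_on_mono_Suc[OF Suc.prems] Ck_on_SucD(2)[OF Suc.prems])
  moreover have eq: "D (Suc n) (F x) * pdiff i F x = pdiff i (\<lambda>x. D n (F x)) x" if "x \<in> U" for i x
    by (subst pdiff_eq[OF d[OF that]]) (simp add: pdiff_def)
  ultimately have "Ck_on k U (pdiff i (\<lambda>x. D n (F x)))" for i
    by (intro Ck_on_cong[OF assms(1) _ eq]) auto
  moreover have "(\<lambda>x. D n (F x)) differentiable_on U"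
    by (rule differentiable_at_imp_differentiable_on) (erule differentiableI[OF d])
  ultimately show ?case by (intro Ck_on_SucI)
qed

lemma has_derivative_vecI:
  fixes F :: "'a::euclidean_space \<Rightarrow> 'b::euclidean_space^'m"
  assumes "\<And>j. ((\<lambda>x. F x $ j) has_derivative (\<lambda>h. D h $ j)) (at x)"
  shows "(F has_derivative D) (at x)"
  unfolding has_derivative_def
proof
  have l: "linear (\<lambda>h. D h $ j)" for j
    using assms[of j] has_derivative_linear by blast
  have "linear D"
    by (rule linearI) (simp_all add: vec_eq_iff linear_add[OF l] linear_scale[OF l])
  then show "bounded_linear D" by (simp add: linear_conv_bounded_linear)
  show "((\<lambda>y. ((F y - F (Lim (at x) (\<lambda>x. x))) - D (y - Lim (at x) (\<lambda>x. x))) /\<^sub>R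
      norm (y - Lim (at x) (\<lambda>x. x))) \<longlongrightarrow> 0) (at x)"
    using assms unfolding has_derivative_def by (intro vec_tendstoI) simp
qed

lemma Ck_on_vec:
  fixes F :: "real^'n \<Rightarrow> 'b::euclidean_space^'m"
  assumes "open U"
  shows "(\<And>j. Ck_on k U (\<lambda>x. F x $ j)) \<Longrightarrow> Ck_on k U F"
proof (induction k arbitrary: F)
  case 0
  have "continuous_on U (\<lambda>x. \<chi> j. F x $ j)" using 0 by (intro continuous_on_vec_lambda) simp
  then show ?case by simp
next
  case (Suc k)
  have d: "(F has_derivative (\<lambda>h. \<chi> j. frechet_derivative (\<lambda>x. F x $ j) (at x) h)) (at x)" if "x \<in> U" for x
  proof -
    have d: "((\<lambda>x. F x $ j) has_derivative frechet_derivative (\<lambda>x. F x $ j) (at x)) (at x)" for j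
      using Ck_on_differentiable[OF Suc.prems assms(1) that] unfolding frechet_derivative_works .
    show ?thesis by (rule has_derivative_vecI) (simp add: d)
  qed
  have "Ck_on k U (\<lambda>x. pdiff i F x $ j)" for i j
  proof -
    have eq: "pdiff i (\<lambda>x. F x $ j) x = pdiff i F x $ j" if "x \<in> U" for x
      by (subst pdiff_eq[OF d[OF that]]) (simp add: pdiff_def)
    show ?thesis by (rule Ck_on_cong[OF assms Ck_on_SucD(2)[OF Suc.prems] eq])
  qed
  then have "Ck_on k U (pdiff i F)" for i by (rule Suc.IH)
  moreover have "F differentiable_on U"
    by (rule differentiable_at_imp_differentiable_on) (erule differentiableI[OF d])
  ultimately show ?case by (intro Ck_on_SucI)
qed

lemma smooth_on_const: "smooth_on U (\<lambda>_. c)"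
  and smooth_on_nth: "smooth_on U (\<lambda>x. x $ i)"
  by (simp_all add: smooth_on_def Ck_on_const Ck_on_nth)

lemma smooth_on_add: "open U \<Longrightarrow> smooth_on U F \<Longrightarrow> smooth_on U F' \<Longrightarrow> smooth_on U (\<lambda>x. F x + F' x)"
  by (simp add: smooth_on_def Ck_on_add)

lemma smooth_on_mult:
  "open U \<Longrightarrow> smooth_on U F \<Longrightarrow> smooth_on U F' \<Longrightarrow> smooth_on U (\<lambda>x. F x * F' x :: real)"
  by (simp add: smooth_on_def Ck_on_mult)

lemma smooth_on_diff:
  assumes "open U" "smooth_on U F" "smooth_on U F'"
  shows "smooth_on U (\<lambda>x. F x - F' x :: real)"
  using smooth_on_add[OF assms(1,2) smooth_on_mult[OF assms(1) smooth_on_const[of U "-1"] assms(3)]] by simp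

lemma smooth_on_power:
  assumes "open U" "smooth_on U F"
  shows "smooth_on U (\<lambda>x. F x ^ n :: real)"
  by (induction n) (simp_all add: smooth_on_const smooth_on_mult assms)

lemma smooth_on_vec:
  fixes F :: "real^'n \<Rightarrow> 'b::euclidean_space^'m"
  shows "open U \<Longrightarrow> (\<And>j. smooth_on U (\<lambda>x. F x $ j)) \<Longrightarrow> smooth_on U F"
  by (simp add: smooth_on_def Ck_on_vec)

lemma smooth_on_sin:
  fixes F :: "real^'n \<Rightarrow> real"
  assumes "open U" "smooth_on U F" shows "smooth_on U (\<lambda>x. sin (F x))"
proof -
  \<comment> \<open>Each differentiation of the sine shifts the phase by a quarter period.\<close>
  have "derivative_tower (\<lambda>n t. sin (t + real n * (pi/2))) UNIV"
    unfolding derivative_tower_def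
  proof (intro allI ballI)
    fix n t
    have "t + real (Suc n) * (pi/2) = (t + real n * (pi/2)) + pi/2" by (simp add: field_simps)
    then have "sin (t + real (Suc n) * (pi/2)) = sin ((t + real n * (pi/2)) + pi/2)" by (rule arg_cong)
    also have "\<dots> = cos (t + real n * (pi/2))"
      by (simp only: sin_add) simp
    finally show "((\<lambda>t. sin (t + real n * (pi/2))) has_real_derivative sin (t + real (Suc n) * (pi/2))) (at t)"
      by (auto intro!: derivative_eq_intros)
  qed
  from Ck_on_compose[OF assms(1) this, of F _ 0] assms(2) show ?thesis by (simp add: smooth_on_def)
qed

lemma smooth_on_cos:
  fixes F :: "real^'n \<Rightarrow> real"
  assumes "open U" "smooth_on U F" shows "smooth_on U (\<lambda>x. cos (F x))"
  using smooth_on_sin[OF assms(1) smooth_on_add[OF assms smooth_on_const[of U "pi/2"]]]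
  by (simp add: sin_add)

lemma smooth_on_powr:
  fixes F :: "real^'n \<Rightarrow> real"
  assumes "open U" "\<And>x. x \<in> U \<Longrightarrow> F x > 0" "smooth_on U F" shows "smooth_on U (\<lambda>x. F x powr a)"
proof -
  have "derivative_tower (\<lambda>n t. (\<Prod>i<n. a - real i) * t powr (a - real n)) {0<..}"
    unfolding derivative_tower_def
  proof (intro allI ballI)
    fix n and t :: real assume "t \<in> {0<..}"
    then show "((\<lambda>t. (\<Prod>i<n. a - real i) * t powr (a - real n)) has_real_derivative
        (\<Prod>i<Suc n. a - real i) * t powr (a - real (Suc n))) (at t)"
      by (auto intro!: derivative_eq_intros simp: diff_diff_eq add.commute)
  qed
  from Ck_on_compose[OF assms(1) this, of F _ 0] assms(2,3) show ?thesis by (simp add: smooth_on_def)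
qed

lemma smooth_on_divide:
  fixes F F' :: "real^'n \<Rightarrow> real"
  assumes "open U" "\<And>x. x \<in> U \<Longrightarrow> F' x > 0" "smooth_on U F" "smooth_on U F'"
  shows "smooth_on U (\<lambda>x. F x / F' x :: real)"
proof (rule smooth_on_cong[OF assms(1)])
  \<comment> \<open>Division by a positive function is multiplication by a real power of it.\<close>
  show "smooth_on U (\<lambda>x. F x * F' x powr (-1))"
    using assms by (intro smooth_on_mult smooth_on_powr)
qed (simp add: assms(2) powr_minus_divide less_imp_le)

lemma smooth_on_sqrt:
  assumes "open U" "\<And>x. x \<in> U \<Longrightarrow> F x > 0" "smooth_on U F"
  shows "smooth_on U (\<lambda>x. sqrt (F x))"
proof (rule smooth_on_cong[OF assms(1)])
  show "smooth_on U (\<lambda>x. F x powr (1/2))"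
    using assms by (intro smooth_on_powr)
qed (simp add: assms(2) powr_half_sqrt less_imp_le)

section \<open>Parametrizations of the sphere by polar coordinates\<close>

definition polar_param :: "real^2 \<Rightarrow> real^3" where
  "polar_param x = sph (x $ 1) (x $ 2)"

text \<open>
  The chart at the poles is the polar chart with the coordinates of the ambient space permuted cyclically, so both
  kinds of charts of the sphere are polar coordinates followed by a permutation of coordinates.
\<close>

definition permute_coords :: "('n \<Rightarrow> 'n) \<Rightarrow> real^'n \<Rightarrow> real^'n" where
  "permute_coords \<sigma> v = (\<chi> i. v $ \<sigma> i)"

text \<open>
  The projection to the equatorial plane, turned so that the centre \<open>c\<close> of the angle window lies on the positive
  real axis. The image of the window is then the complement of the slit along which \<open>Arg\<close> jumps, which gives the
  openness of the image and the continuity of the inverse of the parametrization.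
\<close>

definition horizontal :: "real \<Rightarrow> real^3 \<Rightarrow> complex" where
  "horizontal c p = Complex (p $ 1) (p $ 2) * cis (- c)"

definition polar_coords :: "real \<Rightarrow> real^3 \<Rightarrow> real^2" where
  "polar_coords c p = (\<chi> i. if i = 1 then arccos (p $ 3) else c + Arg (horizontal c p))"

lemma open_polar_dom: "open (polar_dom c)"
  unfolding polar_dom_def by (intro open_Collect_conj open_Collect_less continuous_intros)

lemma polar_dom_bounds:
  assumes "x \<in> polar_dom c"
  shows "0 < x $ 1" "x $ 1 < pi" "0 < sin (x $ 1)"
  using assms by (auto simp: polar_dom_def intro: sin_gt_zero)

lemma horizontal_sph: "horizontal c (sph r \<theta>) = rcis (sin r) (\<theta> - c)"
  by (simp add: horizontal_def sph_def complex_eq_iff cos_diff sin_diff algebra_simps)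

lemma horizontal_polar_param:
  assumes x: "x \<in> polar_dom c"
  shows "horizontal c (polar_param x) \<notin> \<real>\<^sub>\<le>\<^sub>0"
proof
  define t where "t = x $ 2 - c"
  have t: "- pi < t" "t < pi" and s: "0 < sin (x $ 1)"
    using x by (auto simp: polar_dom_def t_def intro: sin_gt_zero)
  assume "horizontal c (polar_param x) \<in> \<real>\<^sub>\<le>\<^sub>0"
  then have "sin (x $ 1) * cos t \<le> 0" "sin (x $ 1) * sin t = 0"
    by (simp_all add: polar_param_def horizontal_sph complex_nonpos_Reals_iff t_def)
  with s have "cos t \<le> 0" "sin t = 0" by (simp_all add: mult_le_0_iff)
  with t have "t = 0" by (simp add: sin_eq_0_pi)
  with \<open>cos t \<le> 0\<close> show False by simp
qed

lemma polar_coords_polar_param: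
  assumes x: "x \<in> polar_dom c"
  shows "polar_coords c (polar_param x) = x"
proof -
  have "Arg (horizontal c (polar_param x)) = x $ 2 - c"
    unfolding polar_param_def horizontal_sph
    by (rule Arg_rcis) (use x in \<open>auto simp: polar_dom_def intro: sin_gt_zero\<close>)
  moreover have "arccos (polar_param x $ 3) = x $ 1"
    using polar_dom_bounds[OF x] by (simp add: polar_param_def sph_def arccos_cos)
  ultimately show ?thesis by (simp add: polar_coords_def vec_eq_iff forall_2)
qed

lemma horizontal_nonpos_pole: "p \<in> {north, south} \<Longrightarrow> horizontal c p \<in> \<real>\<^sub>\<le>\<^sub>0"
  by (auto simp: horizontal_def north_def south_def axis_def complex_nonpos_Reals_iff)

text \<open>
  The poles are excluded as well, since they project to the origin, which lies on the slit.
\<close>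

lemma mem_polar_param_image:
  assumes p: "p \<in> sphere 0 1" "horizontal c p \<notin> \<real>\<^sub>\<le>\<^sub>0"
  shows "p \<in> polar_param ` polar_dom c"
proof -
  have "p \<notin> {north, south}" using horizontal_nonpos_pole p(2) by blast
  then obtain r \<theta> where r: "0 < r" "r < pi" and p': "p = sph r \<theta>"
    using sph_surj[of p] p(1) by auto
  have s: "0 < sin r" using r by (rule sin_gt_zero)
  define t where "t = Arg (horizontal c p)"
  have nz: "horizontal c p \<noteq> 0" using p(2) by auto
  have "cis t = sgn (horizontal c p)" unfolding t_def using nz by (rule cis_Arg)
  also have "\<dots> = cis (\<theta> - c)"
    using s by (simp add: p' horizontal_sph rcis_def sgn_eq norm_mult)
  finally have "cis t * cis c = cis (\<theta> - c) * cis c" by simp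
  then have "cis (c + t) = cis \<theta>" by (simp add: cis_mult add.commute)
  then have "p = sph r (c + t)" by (simp add: p' sph_def complex_eq_iff)
  moreover have "t \<noteq> pi" using p(2) by (auto simp: t_def Arg_eq_pi complex_nonpos_Reals_iff)
  ultimately show ?thesis
    using r mpi_less_Arg[of "horizontal c p"] Arg_le_pi[of "horizontal c p"]
    by (intro image_eqI[of _ _ "\<chi> i. if i = 1 then r else c + t"])
      (auto simp: polar_param_def polar_dom_def t_def)
qed

lemma polar_param_in_punctured: "x \<in> polar_dom c \<Longrightarrow> polar_param x \<in> sphere 0 1 - {north, south}"
  unfolding polar_param_def using polar_dom_bounds by (intro sph_in_punctured)

lemma polar_param_image:
  "polar_param ` polar_dom c = sphere 0 1 \<inter> {p. horizontal c p \<in> - \<real>\<^sub>\<le>\<^sub>0}"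
  using polar_param_in_punctured horizontal_polar_param mem_polar_param_image by blast

lemma continuous_on_horizontal: "continuous_on S (\<lambda>p. horizontal c (F p))"
  if "continuous_on S F"
  unfolding horizontal_def Complex_eq using that by (intro continuous_intros)

lemma continuous_on_permute: "continuous_on S (permute_coords \<sigma>)"
  unfolding permute_coords_def by (intro continuous_intros)

lemma permute_coords_inverse:
  assumes "bij \<sigma>"
  shows "permute_coords (inv \<sigma>) (permute_coords \<sigma> v) = v" "permute_coords \<sigma> (permute_coords (inv \<sigma>) v) = v"
  using assms by (simp_all add: permute_coords_def vec_eq_iff bij_is_surj surj_f_inv_f bij_is_inj)

lemma inner_permute_coords:
  assumes "bij \<sigma>"
  shows "permute_coords \<sigma> v \<bullet> permute_coords \<sigma> w = v \<bullet> w"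
  using sum.reindex_bij_betw[of \<sigma> UNIV UNIV "\<lambda>i. v $ i * w $ i"] assms
  by (simp add: permute_coords_def inner_vec_def)

lemma permute_coords_sphere:
  assumes "bij \<sigma>"
  shows "permute_coords \<sigma> v \<in> sphere 0 1 \<longleftrightarrow> v \<in> sphere 0 1"
  by (simp add: norm_eq_sqrt_inner inner_permute_coords[OF assms])

definition polar_param_deriv :: "real^2 \<Rightarrow> real^2 \<Rightarrow> real^3" where
  "polar_param_deriv x h = vector [h $ 1 * cos (x $ 1) * cos (x $ 2) - h $ 2 * sin (x $ 1) * sin (x $ 2),
                  h $ 1 * cos (x $ 1) * sin (x $ 2) + h $ 2 * sin (x $ 1) * cos (x $ 2),
                  - h $ 1 * sin (x $ 1)]"

lemma has_derivative_permute_polar_param: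
  "((\<lambda>x. permute_coords \<sigma> (polar_param x)) has_derivative (\<lambda>h. permute_coords \<sigma> (polar_param_deriv x h))) (at x)"
proof -
  have d: "(polar_param has_derivative polar_param_deriv x) (at x)"
    using has_derivative_sph[of x] unfolding polar_param_def[abs_def] polar_param_deriv_def[abs_def] .
  have "linear (permute_coords \<sigma>)"
    by (rule linearI) (simp_all add: permute_coords_def vec_eq_iff)
  then have "bounded_linear (permute_coords \<sigma>)" by (simp add: linear_conv_bounded_linear)
  then show ?thesis by (rule bounded_linear.has_derivative) (rule d)
qed

text \<open>
  Away from the poles \<open>sin r\<close> does not vanish: the third component of the derivative determines \<open>h $ 1\<close>, and then
  the horizontal components determine \<open>h $ 2\<close>.
\<close>

lemma inj_polar_param_deriv:
  assumes "0 < r" "r < pi" "x $ 1 = r"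
  shows "inj (polar_param_deriv x)"
proof -
  have s: "0 < sin (x $ 1)" using assms by (simp add: sin_gt_zero)
  have "v = 0" if v: "polar_param_deriv x v = 0" for v
  proof -
    have "v $ 1 = 0" using v s by (simp add: polar_param_deriv_def vec_eq_iff forall_3)
    moreover have "v $ 1 * cos (x $ 1) * cos (x $ 2) - v $ 2 * sin (x $ 1) * sin (x $ 2) = 0"
        "v $ 1 * cos (x $ 1) * sin (x $ 2) + v $ 2 * sin (x $ 1) * cos (x $ 2) = 0"
      using v by (simp_all add: polar_param_deriv_def vec_eq_iff forall_3)
    moreover have "sin (x $ 2) \<noteq> 0 \<or> cos (x $ 2) \<noteq> 0"
      using sin_zero_abs_cos_one[of "x $ 2"] by auto
    ultimately have "v $ 2 = 0" using s by auto
    with \<open>v $ 1 = 0\<close> show "v = 0" by (simp add: vec_eq_iff forall_2)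
  qed
  moreover have "linear (polar_param_deriv x)"
    by (rule linearI) (simp_all add: polar_param_deriv_def vec_eq_iff forall_3 algebra_simps)
  ultimately show ?thesis by (simp add: linear_injective_0)
qed

lemma inj_permute_polar_param_deriv:
  assumes "bij \<sigma>" "x \<in> polar_dom c"
  shows "inj (frechet_derivative (\<lambda>x. permute_coords \<sigma> (polar_param x)) (at x))"
proof -
  have "inj (permute_coords \<sigma>)"
    using permute_coords_inverse(1)[OF assms(1)] by (rule inj_on_inverseI)
  then have "inj (\<lambda>h. permute_coords \<sigma> (polar_param_deriv x h))"
    using inj_polar_param_deriv[OF polar_dom_bounds(1,2)[OF assms(2)] refl]
    by (simp add: inj_def)
  then show ?thesis
    using frechet_derivative_at[OF has_derivative_permute_polar_param[of \<sigma> x]] by simp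
qed

lemma smooth_on_permute_polar_param:
  assumes "open U"
  shows "smooth_on U (\<lambda>x. permute_coords \<sigma> (polar_param x))"
proof (rule smooth_on_vec[OF assms])
  have "smooth_on U (\<lambda>x. polar_param x $ j)" for j
  proof -
    consider "j = 1" | "j = 2" | "j = 3" using exhaust_3 by blast
    then show ?thesis
      unfolding polar_param_def sph_def
      by cases (simp_all, (intro smooth_on_mult smooth_on_sin smooth_on_cos smooth_on_nth assms)+)
  qed
  then show "smooth_on U (\<lambda>x. permute_coords \<sigma> (polar_param x) $ j)" for j
    by (simp add: permute_coords_def)
qed

lemma image_inverse_vimage:
  assumes "\<And>v. g (f v) = v" "\<And>v. f (g v) = v"
  shows "f ` A = {p. g p \<in> A}"
proof (intro set_eqI iffI)
  show "p \<in> {p. g p \<in> A}" if "p \<in> f ` A" for p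
    using that assms(1) by force
  show "p \<in> f ` A" if "p \<in> {p. g p \<in> A}" for p
    using that by (intro image_eqI[of _ _ "g p"]) (simp_all add: assms(2))
qed

text \<open>
  The explicit inverse \<open>(arccos, c + Arg)\<close> is continuous off the slit, and the slit is closed.
\<close>

lemma local_param_sphere:
  assumes \<sigma>: "bij \<sigma>"
  shows "local_param (sphere 0 1) (polar_dom c) (\<lambda>x. permute_coords \<sigma> (polar_param x))"
proof -
  let ?\<psi> = "\<lambda>x. permute_coords \<sigma> (polar_param x)"
  let ?inv = "\<lambda>p. polar_coords c (permute_coords (inv \<sigma>) p)"
  have left: "?inv (?\<psi> x) = x" if "x \<in> polar_dom c" for x
    using that by (simp add: permute_coords_inverse[OF \<sigma>] polar_coords_polar_param)
  then have inj: "inj_on ?\<psi> (polar_dom c)" by (rule inj_on_inverseI)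
  have img: "?\<psi> ` polar_dom c =
      sphere 0 1 \<inter> (\<lambda>p. horizontal c (permute_coords (inv \<sigma>) p)) -` (- \<real>\<^sub>\<le>\<^sub>0)" (is "_ = _ \<inter> ?W")
  proof -
    have "?\<psi> ` polar_dom c = permute_coords \<sigma> ` (polar_param ` polar_dom c)" by (simp add: image_image)
    also have "\<dots> = {p. permute_coords (inv \<sigma>) p \<in> polar_param ` polar_dom c}"
    proof (rule image_inverse_vimage)
      show "permute_coords (inv \<sigma>) (permute_coords \<sigma> v) = v" "permute_coords \<sigma> (permute_coords (inv \<sigma>) v) = v" for v
        by (rule permute_coords_inverse[OF \<sigma>])+
    qed
    also have "\<dots> = sphere 0 1 \<inter> ?W"
      unfolding polar_param_image
      by (intro set_eqI)
        (simp only: Int_iff mem_Collect_eq vimage_def permute_coords_sphere[OF bij_imp_bij_inv[OF \<sigma>]])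
    finally show ?thesis .
  qed
  have "open ?W"
    by (intro open_vimage continuous_on_horizontal continuous_on_permute)
      (simp add: open_Compl)
  then have op: "openin (top_of_set (sphere 0 1)) (?\<psi> ` polar_dom c)"
    unfolding img by (rule openin_open_Int)
  have "continuous_on (?\<psi> ` polar_dom c) ?inv"
  proof -
    have h: "horizontal c (permute_coords (inv \<sigma>) p) \<notin> \<real>\<^sub>\<le>\<^sub>0" if "p \<in> ?\<psi> ` polar_dom c" for p
      using that unfolding img by auto
    have b: "- 1 \<le> permute_coords (inv \<sigma>) p $ 3 \<and> permute_coords (inv \<sigma>) p $ 3 \<le> 1"
      if "p \<in> ?\<psi> ` polar_dom c" for p
    proof -
      have "norm p = 1" using that unfolding img by auto
      then have "\<bar>p $ inv \<sigma> 3\<bar> \<le> 1" using component_le_norm_cart[of p "inv \<sigma> 3"] by simp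
      then show ?thesis by (auto simp: permute_coords_def)
    qed
    have nth: "continuous_on S (\<lambda>p. permute_coords (inv \<sigma>) p $ 3)" for S
      unfolding permute_coords_def by (simp, intro continuous_intros)
    have "continuous_on (?\<psi> ` polar_dom c) (\<lambda>p. if i = 1 then arccos (permute_coords (inv \<sigma>) p $ 3)
        else c + Arg (horizontal c (permute_coords (inv \<sigma>) p)))" for i :: 2
    proof (cases "i = 1")
      case True
      have "continuous_on (?\<psi> ` polar_dom c) (\<lambda>p. arccos (permute_coords (inv \<sigma>) p $ 3))"
        by (intro continuous_on_arccos nth) (use b in blast)
      then show ?thesis by (simp only: True simp_thms if_True)
    next
      case False
      have "continuous_on (?\<psi> ` polar_dom c) (\<lambda>p. c + Arg (horizontal c (permute_coords (inv \<sigma>) p)))"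
        by (intro continuous_on_add continuous_on_const continuous_on_Arg' continuous_on_horizontal
            continuous_on_permute) (use h in blast)
      then show ?thesis by (simp only: False if_False)
    qed
    then show ?thesis unfolding polar_coords_def by (rule continuous_on_vec_lambda)
  qed
  moreover have "?inv p = inv_into (polar_dom c) ?\<psi> p" if p: "p \<in> ?\<psi> ` polar_dom c" for p
  proof -
    from p obtain x where x: "x \<in> polar_dom c" "p = ?\<psi> x" by blast
    then show ?thesis using left inv_into_f_f[OF inj] by simp
  qed
  ultimately have "continuous_on (?\<psi> ` polar_dom c) (inv_into (polar_dom c) ?\<psi>)"
    by (rule continuous_on_eq)
  with inj op show ?thesis
    unfolding local_param_def
    using open_polar_dom smooth_on_permute_polar_param[OF open_polar_dom] inj_permute_polar_param_deriv[OF \<sigma>]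
    by blast
qed

lemma local_param_subset:
  assumes "local_param S U \<psi>" "\<psi> ` U \<subseteq> T" "T \<subseteq> S"
  shows "local_param T U \<psi>"
  using assms openin_subset_trans[of S "\<psi> ` U" T] unfolding local_param_def by blast

section \<open>Conformal metrics on the sphere\<close>

definition diag2 :: "real \<Rightarrow> real \<Rightarrow> real^2^2" where
  "diag2 a b = (\<chi> i j. if i \<noteq> j then 0 else if i = 1 then a else b)"

lemma pdiff_permute_polar_param:
  "pdiff i (\<lambda>x. permute_coords \<sigma> (polar_param x)) x = permute_coords \<sigma> (pdiff i (\<lambda>x. sph (x $ 1) (x $ 2)) x)"
  using pdiff_eq[OF has_derivative_permute_polar_param[of \<sigma> x], of i] pdiff_eq[OF has_derivative_sph[of x], of i]
  by (simp add: polar_param_deriv_def)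

text \<open>
  Permuting coordinates is an isometry, so every chart sees the metric of the polar chart.
\<close>

lemma metric_at_sphere:
  assumes "bij \<sigma>" "param_at M p = (\<lambda>x. permute_coords \<sigma> (polar_param x))"
    and "\<And>v w. rmetric M (param_at M p x) v w = h * (v \<bullet> w)"
  shows "metric_at M p x = diag2 h (h * (sin (x $ 1))\<^sup>2)"
proof -
  have "rmetric M (param_at M p x) (pdiff i (param_at M p) x) (pdiff j (param_at M p) x)
      = h * round_metric undefined (pdiff i (\<lambda>x. sph (x $ 1) (x $ 2)) x) (pdiff j (\<lambda>x. sph (x $ 1) (x $ 2)) x)" for i j
    unfolding assms(3) unfolding assms(2) pdiff_permute_polar_param inner_permute_coords[OF assms(1)] round_metric_def ..
  then show ?thesis
    unfolding metric_at_def round_metric_polar by (simp add: diag2_def vec_eq_iff)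
qed

lemma smooth_on_diag2:
  assumes "open U" "smooth_on U a" "smooth_on U b"
  shows "smooth_on U (\<lambda>x. diag2 (a x) (b x))"
proof (intro smooth_on_vec assms(1))
  fix i j :: 2
  consider "i \<noteq> j" | "i = j" "i = 1" | "i = j" "i \<noteq> 1" by blast
  then show "smooth_on U (\<lambda>x. diag2 (a x) (b x) $ i $ j)"
    by cases (simp_all add: diag2_def smooth_on_const assms(2,3))
qed

text \<open>
  One criterion for the round sphere and for both metrics on the punctured sphere: a conformal factor \<open>h\<close> times the
  Euclidean inner product, with all charts being permuted polar coordinates.
\<close>

lemma riemannian_manifold_conformal_sphere:
  fixes M :: "(real^3, 2) rmanifold"
  assumes sub: "pts M \<subseteq> sphere 0 1"
    and chart: "\<And>p. p \<in> pts M \<Longrightarrow> \<exists>\<sigma> c. bij \<sigma> \<and> chart_at M p = (polar_dom c, \<lambda>x. permute_coords \<sigma> (polar_param x))"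
    and mem: "\<And>p. p \<in> pts M \<Longrightarrow> p \<in> param_at M p ` dom_at M p"
    and img: "\<And>p. p \<in> pts M \<Longrightarrow> param_at M p ` dom_at M p \<subseteq> pts M"
    and metric: "\<And>p v w. rmetric M p v w = h p * (v \<bullet> w)"
    and pos: "\<And>p. p \<in> pts M \<Longrightarrow> h p > 0"
    and smooth: "smooth_fun M h"
  shows "riemannian_manifold M"
  unfolding riemannian_manifold_def
proof (intro ballI conjI allI impI)
  fix p assume p: "p \<in> pts M"
  from chart[OF p] obtain \<sigma> c where \<sigma>: "bij \<sigma>"
    and c: "chart_at M p = (polar_dom c, \<lambda>x. permute_coords \<sigma> (polar_param x))" by blast
  have dom: "dom_at M p = polar_dom c" and par: "param_at M p = (\<lambda>x. permute_coords \<sigma> (polar_param x))"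
    by (simp_all add: c)
  show "local_param (pts M) (dom_at M p) (param_at M p)"
    using local_param_subset[OF local_param_sphere[OF \<sigma>] _ sub] img[OF p] unfolding dom par by blast
  show "p \<in> param_at M p ` dom_at M p" by (rule mem[OF p])
  show "bilinear (rmetric M p)"
    unfolding bilinear_def metric[abs_def]
    by (auto intro!: linearI simp: inner_add_left inner_add_right algebra_simps)
  show "rmetric M p v w = rmetric M p w v" for v w
    by (simp add: metric inner_commute)
  show "rmetric M p v v > 0" if "v \<noteq> 0" for v
    using that pos[OF p] by (simp add: metric)
  have m: "metric_at M p x = diag2 (h (param_at M p x)) (h (param_at M p x) * (sin (x $ 1))\<^sup>2)" for x
    by (rule metric_at_sphere[OF \<sigma> par metric])
  have "smooth_on (polar_dom c) (\<lambda>x. h (param_at M p x))"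
    using smooth p by (auto simp: smooth_fun_def dom comp_def)
  then show "smooth_on (dom_at M p) (metric_at M p)"
    unfolding m[abs_def] dom
    by (intro smooth_on_diag2 smooth_on_mult smooth_on_power smooth_on_sin smooth_on_nth open_polar_dom)
qed

abbreviation azimuth :: "real^3 \<Rightarrow> real" where
  "azimuth p \<equiv> Arg (Complex (p $ 1) (p $ 2))"

text \<open>
  The cyclic permutation is subtraction of one in the index type of integers modulo three, where \<open>3\<close> is \<open>0\<close>.
\<close>

lemma zero_3: "(0::3) = 3"
  using exhaust_3[of 0] by auto

lemma sphere_chart_pole:
  assumes "p \<in> {north, south}"
  shows "sphere_chart p = (polar_dom 0, \<lambda>x. permute_coords (\<lambda>i. i - 1) (polar_param x))"
  using assms by (simp add: sphere_chart_def Let_def polar_param_def permute_coords_def vec_eq_iff forall_3 fun_eq_iff zero_3)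

lemma permute_coords_id: "permute_coords (\<lambda>i. i) v = v"
  by (simp add: permute_coords_def)

lemma sphere_chart_nonpole:
  assumes "p \<notin> {north, south}"
  shows "sphere_chart p = (polar_dom (azimuth p), polar_param)"
  using assms by (simp add: sphere_chart_def polar_param_def[abs_def])

lemma bij_shift3: "bij (\<lambda>i::3. i - 1)"
  by (rule bij_betw_byWitness[of _ "\<lambda>i. i + 1"]) auto

lemma mem_sphere_chart:
  assumes "p \<in> sphere 0 1"
  shows "p \<in> snd (sphere_chart p) ` fst (sphere_chart p)"
proof (cases "p \<in> {north, south}")
  case False
  then obtain r \<theta> where r: "0 < r" "r < pi" and p: "p = sph r \<theta>"
    using sph_surj[of p] assms by auto
  define z where "z = Complex (p $ 1) (p $ 2)"
  have "z = rcis (sin r) \<theta>" using horizontal_sph[of 0 r \<theta>] by (simp add: z_def horizontal_def p)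
  then have "z \<noteq> 0" using sin_gt_zero[OF r] by (simp add: rcis_def)
  have "z = of_real (cmod z) * cis (Arg z)" using rcis_cmod_Arg[of z] by (simp add: rcis_def)
  then have "horizontal (azimuth p) p = of_real (cmod z) * (cis (Arg z) * cis (- Arg z))"
    unfolding horizontal_def z_def[symmetric] by (metis mult.assoc)
  then have "horizontal (azimuth p) p = of_real (cmod z)" by (simp add: cis_mult)
  then have "horizontal (azimuth p) p \<notin> \<real>\<^sub>\<le>\<^sub>0" using \<open>z \<noteq> 0\<close> by (simp add: complex_nonpos_Reals_iff)
  from mem_polar_param_image[OF assms this] show ?thesis by (simp add: sphere_chart_nonpole[OF False])
next
  case True
  \<comment> \<open>In the permuted chart the poles lie on the equator, at the angles \<open>\<plusminus> \<pi>/2\<close>.\<close>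
  define s :: real where "s = (if p = north then 1 else - 1)"
  define x :: "real^2" where "x = (\<chi> i. if i = 1 then pi/2 else s * (pi/2))"
  have "p = permute_coords (\<lambda>i. i - 1) (polar_param x)"
    using True by (auto simp: permute_coords_def polar_param_def sph_def x_def s_def vec_eq_iff forall_3
        north_def south_def axis_def zero_3)
  moreover have "x \<in> polar_dom 0" by (auto simp: x_def polar_dom_def s_def)
  ultimately show ?thesis unfolding sphere_chart_pole[OF True] by simp
qed

lemma sphere_chart_image: "p \<in> sphere 0 1 - {north, south} \<Longrightarrow>
    snd (sphere_chart p) ` fst (sphere_chart p) \<subseteq> sphere 0 1 - {north, south}"
  using polar_param_in_punctured by (auto simp: sphere_chart_nonpole)

lemma sphere_chart_frame:
  "\<exists>\<sigma> c. bij \<sigma> \<and> sphere_chart p = (polar_dom c, \<lambda>x. permute_coords \<sigma> (polar_param x))"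
proof (cases "p \<in> {north, south}")
  case True
  then show ?thesis using sphere_chart_pole bij_shift3 by blast
next
  case False
  have "bij (\<lambda>i::3. i)" by (rule bij_id[unfolded id_def])
  moreover have "sphere_chart p = (polar_dom (azimuth p), \<lambda>x. permute_coords (\<lambda>i. i) (polar_param x))"
    by (simp only: sphere_chart_nonpole[OF False] permute_coords_id)
  ultimately show ?thesis by blast
qed

lemma riemannian_round_sphere: "riemannian_manifold round_sphere"
proof (rule riemannian_manifold_conformal_sphere)
  show "rmetric round_sphere p v w = 1 * (v \<bullet> w)" for p v w
    by (simp add: round_sphere_def round_metric_def)
  show "smooth_fun round_sphere (\<lambda>_. 1 :: real)"
    by (simp add: smooth_fun_def comp_def smooth_on_const)
  show "param_at round_sphere p ` dom_at round_sphere p \<subseteq> pts round_sphere" for p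
  proof -
    obtain \<sigma> c where "bij \<sigma>" and c: "sphere_chart p = (polar_dom c, \<lambda>x. permute_coords \<sigma> (polar_param x))"
      using sphere_chart_frame by blast
    then show ?thesis
      using permute_coords_sphere[of \<sigma>] polar_param_in_punctured unfolding round_sphere_def by fastforce
  qed
qed (use mem_sphere_chart sphere_chart_frame in \<open>simp_all add: round_sphere_def\<close>)

lemma riemannian_punctured_sphere:
  assumes metric: "\<And>p v w. g p v w = h p * (v \<bullet> w)"
    and pos: "\<And>p. p \<in> sphere 0 1 - {north, south} \<Longrightarrow> h p > 0"
    and smooth: "smooth_fun (punctured_sphere g) h"
  shows "riemannian_manifold (punctured_sphere g)"
proof (rule riemannian_manifold_conformal_sphere[OF _ _ _ _ _ _ smooth])
  show "param_at (punctured_sphere g) p ` dom_at (punctured_sphere g) p \<subseteq> pts (punctured_sphere g)"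
    if "p \<in> pts (punctured_sphere g)" for p
    using that sphere_chart_image unfolding punctured_sphere_def by simp
qed (use mem_sphere_chart sphere_chart_frame metric pos in \<open>simp_all add: punctured_sphere_def\<close>)

lemma smooth_fun_punctured_sphere:
  fixes u :: "real^3 \<Rightarrow> 'b::real_normed_vector"
  assumes "\<And>c. smooth_on (polar_dom c) (\<lambda>x. u (polar_param x))"
  shows "smooth_fun (punctured_sphere g) u"
  using assms by (auto simp: smooth_fun_def punctured_sphere_def sphere_chart_nonpole comp_def)

section \<open>Rotationally symmetric maps in polar coordinates\<close>

abbreviation e1 :: "real^2" where "e1 \<equiv> axis 1 1"
abbreviation e2 :: "real^2" where "e2 \<equiv> axis 2 1"

lemma diag2_nth [simp]:
  "diag2 a b $ 1 $ 1 = a" "diag2 a b $ 1 $ 2 = 0" "diag2 a b $ 2 $ 1 = 0" "diag2 a b $ 2 $ 2 = b"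
  by (simp_all add: diag2_def)

lemma axis2_nth [simp]: "e1 $ 1 = 1" "e1 $ 2 = 0" "e2 $ 1 = 0" "e2 $ 2 = 1"
  by (simp_all add: axis_def)

lemma matrix_inv_diag2:
  assumes "a \<noteq> 0" "b \<noteq> 0"
  shows "matrix_inv (diag2 a b) = diag2 (1/a) (1/b)"
proof -
  have r: "diag2 a b ** diag2 (1/a) (1/b) = mat 1" and l: "diag2 (1/a) (1/b) ** diag2 a b = mat 1"
    using assms by (simp_all add: matrix_matrix_mult_def vec_eq_iff forall_2 sum_2 mat_def)
  from r l have "diag2 a b ** diag2 (1/a) (1/b) = mat 1 \<and> diag2 (1/a) (1/b) ** diag2 a b = mat 1" ..
  then have "diag2 a b ** matrix_inv (diag2 a b) = mat 1 \<and> matrix_inv (diag2 a b) ** diag2 a b = mat 1"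
    unfolding matrix_inv_def by (rule someI)
  then have "matrix_inv (diag2 a b) ** diag2 a b ** diag2 (1/a) (1/b) = diag2 (1/a) (1/b)"
    by simp
  then show ?thesis by (simp add: matrix_mul_assoc[symmetric] r)
qed

lemma has_derivative_radial:
  fixes x :: "real^2"
  assumes "(g has_real_derivative g') (at (x $ 1))"
  shows "((\<lambda>y. g (y $ 1) *\<^sub>R v) has_derivative (\<lambda>h. (g' * h $ 1) *\<^sub>R v)) (at x)"
proof -
  have "((\<lambda>y. y $ 1) has_derivative (\<lambda>h. h $ 1)) (at x)"
    by (intro bounded_linear_imp_has_derivative bounded_linear_vec_nth)
  from has_derivative_compose[OF this, of g "\<lambda>h. g' * h"] assms
  have "((\<lambda>y. g (y $ 1)) has_derivative (\<lambda>h. g' * h $ 1)) (at x)"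
    by (simp add: has_field_derivative_def)
  then show ?thesis by (rule has_derivative_scaleR_left)
qed

lemma pdiff_radial_vec:
  fixes x :: "real^2"
  assumes "(g has_real_derivative g') (at (x $ 1))"
  shows "pdiff 1 (\<lambda>y. g (y $ 1) *\<^sub>R v) x = g' *\<^sub>R v" "pdiff 2 (\<lambda>y. g (y $ 1) *\<^sub>R v) x = 0"
  by (simp_all add: pdiff_eq[OF has_derivative_radial[OF assms]])

lemma pdiff_radial:
  fixes x :: "real^2"
  assumes "(g has_real_derivative g') (at (x $ 1))"
  shows "pdiff 1 (\<lambda>y. g (y $ 1)) x = g'" "pdiff 2 (\<lambda>y. g (y $ 1)) x = 0"
  using pdiff_radial_vec[where v = "1::real", OF assms] by simp_all

lemma christoffel_diag2:
  assumes U: "open U" "x \<in> U"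
    and G: "\<And>y. y \<in> U \<Longrightarrow> G y = diag2 (a (y $ 1)) (b (y $ 1))"
    and a: "(a has_real_derivative a') (at (x $ 1))" "a (x $ 1) \<noteq> 0"
    and b: "(b has_real_derivative b') (at (x $ 1))" "b (x $ 1) \<noteq> 0"
  shows "christoffel G 1 1 x = (a' / (2 * a (x $ 1))) *\<^sub>R e1"
    "christoffel G 1 2 x = (b' / (2 * b (x $ 1))) *\<^sub>R e2"
    "christoffel G 2 1 x = (b' / (2 * b (x $ 1))) *\<^sub>R e2"
    "christoffel G 2 2 x = (- b' / (2 * a (x $ 1))) *\<^sub>R e1"
proof -
  have p: "pdiff k (\<lambda>y. G y $ i $ j) x = pdiff k (\<lambda>y. diag2 (a (y $ 1)) (b (y $ 1)) $ i $ j) x" for i j k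
    by (rule pdiff_cong_open[OF U]) (simp add: G)
  have d: "pdiff k (\<lambda>y. G y $ 1 $ 1) x = (if k = 1 then a' else 0)"
    "pdiff k (\<lambda>y. G y $ 1 $ 2) x = 0"
    "pdiff k (\<lambda>y. G y $ 2 $ 1) x = 0"
    "pdiff k (\<lambda>y. G y $ 2 $ 2) x = (if k = 1 then b' else 0)" for k :: 2
    using exhaust_2[of k] by (auto simp: p pdiff_radial[OF a(1)] pdiff_radial[OF b(1)] pdiff_const)
  have m: "matrix_inv (G x) = diag2 (1 / a (x $ 1)) (1 / b (x $ 1))"
    using matrix_inv_diag2[OF a(2) b(2)] by (simp add: G[OF U(2)])
  show "christoffel G 1 1 x = (a' / (2 * a (x $ 1))) *\<^sub>R e1"
    "christoffel G 1 2 x = (b' / (2 * b (x $ 1))) *\<^sub>R e2"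
    "christoffel G 2 1 x = (b' / (2 * b (x $ 1))) *\<^sub>R e2"
    "christoffel G 2 2 x = (- b' / (2 * a (x $ 1))) *\<^sub>R e1"
    by (simp_all add: christoffel_def m d vec_eq_iff forall_2 sum_2)
qed

text \<open>
  The coordinate expression of the round metric is nondegenerate on the whole strip, for all angles; the angle
  windows of the charts serve injectivity.
\<close>

definition polar_strip :: "(real^2) set" where
  "polar_strip = {x. 0 < x $ 1 \<and> x $ 1 < pi}"

lemma open_polar_strip: "open polar_strip"
  unfolding polar_strip_def by (intro open_Collect_conj open_Collect_less continuous_intros)

lemma polar_strip_sin: "x \<in> polar_strip \<Longrightarrow> 0 < sin (x $ 1)"
  by (simp add: polar_strip_def sin_gt_zero)

definition round_polar :: "real^2 \<Rightarrow> real^2^2" where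
  "round_polar x = diag2 1 ((sin (x $ 1))\<^sup>2)"

lemma christoffel_round:
  assumes x: "x \<in> polar_strip"
  shows "christoffel round_polar 1 1 x = 0"
    "christoffel round_polar 1 2 x = cot (x $ 1) *\<^sub>R e2"
    "christoffel round_polar 2 1 x = cot (x $ 1) *\<^sub>R e2"
    "christoffel round_polar 2 2 x = (- (sin (x $ 1) * cos (x $ 1))) *\<^sub>R e1"
proof -
  have s: "sin (x $ 1) \<noteq> 0" using polar_strip_sin[OF x] by simp
  have d: "((\<lambda>t. (sin t)\<^sup>2) has_real_derivative 2 * sin (x $ 1) * cos (x $ 1)) (at (x $ 1))"
    by (auto intro!: derivative_eq_intros)
  have c: "((\<lambda>t. 1) has_real_derivative 0) (at (x $ 1))" by simp
  have "2 * sin (x $ 1) * cos (x $ 1) / (2 * (sin (x $ 1))\<^sup>2) = cot (x $ 1)"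
    using s by (simp add: cot_def power2_eq_square)
  with christoffel_diag2[OF open_polar_strip x round_polar_def c _ d] s
  show "christoffel round_polar 1 1 x = 0"
    "christoffel round_polar 1 2 x = cot (x $ 1) *\<^sub>R e2"
    "christoffel round_polar 2 1 x = cot (x $ 1) *\<^sub>R e2"
    "christoffel round_polar 2 2 x = (- (sin (x $ 1) * cos (x $ 1))) *\<^sub>R e1"
    by simp_all
qed

lemma cov_round:
  assumes "x \<in> polar_strip"
  shows "cov round_polar X Y x = frechet_derivative Y (at x) (X x)
    + (- (X x $ 2 * Y x $ 2 * sin (x $ 1) * cos (x $ 1))) *\<^sub>R e1
    + ((X x $ 1 * Y x $ 2 + X x $ 2 * Y x $ 1) * cot (x $ 1)) *\<^sub>R e2"
  by (simp add: cov_def sum_2 christoffel_round[OF assms] vec_eq_iff forall_2 algebra_simps)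

lemma cov_round_const:
  assumes "x \<in> polar_strip"
  shows "cov round_polar (\<lambda>_. v) (\<lambda>_. w) x =
    (- (v $ 2 * w $ 2 * sin (x $ 1) * cos (x $ 1))) *\<^sub>R e1
    + ((v $ 1 * w $ 2 + v $ 2 * w $ 1) * cot (x $ 1)) *\<^sub>R e2"
  by (simp add: cov_round[OF assms] frechet_derivative_const)

text \<open>
  The curvature at constant vector fields is the commutator of two of these second derivatives.
\<close>

lemma cov_round_cov_const:
  assumes x: "x \<in> polar_strip"
  shows "cov round_polar (\<lambda>_. u) (cov round_polar (\<lambda>_. v) (\<lambda>_. w)) x =
    (- (u $ 1 * (v $ 2 * w $ 2) * ((cos (x $ 1))\<^sup>2 - (sin (x $ 1))\<^sup>2))
      - u $ 2 * ((v $ 1 * w $ 2 + v $ 2 * w $ 1) * (cos (x $ 1))\<^sup>2)) *\<^sub>R e1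
    + (- (u $ 1 * (v $ 1 * w $ 2 + v $ 2 * w $ 1) / (sin (x $ 1))\<^sup>2)
      + (u $ 1 * (v $ 1 * w $ 2 + v $ 2 * w $ 1) * (cot (x $ 1))\<^sup>2)
      - u $ 2 * (v $ 2 * w $ 2) * (cos (x $ 1))\<^sup>2) *\<^sub>R e2"
proof -
  let ?p = "\<lambda>t. - (v $ 2 * w $ 2 * sin t * cos t)"
  let ?q = "\<lambda>t. (v $ 1 * w $ 2 + v $ 2 * w $ 1) * cot t"
  let ?Y = "cov round_polar (\<lambda>_. v) (\<lambda>_. w)"
  have s: "sin (x $ 1) \<noteq> 0" using polar_strip_sin[OF x] by simp
  have p: "(?p has_real_derivative - (v $ 2 * w $ 2 * ((cos (x $ 1))\<^sup>2 - (sin (x $ 1))\<^sup>2))) (at (x $ 1))"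
    by (auto intro!: derivative_eq_intros simp: power2_eq_square algebra_simps)
  have q: "(?q has_real_derivative - ((v $ 1 * w $ 2 + v $ 2 * w $ 1) / (sin (x $ 1))\<^sup>2)) (at (x $ 1))"
    using DERIV_cmult[OF DERIV_cot[OF s], of "v $ 1 * w $ 2 + v $ 2 * w $ 1"] by (simp add: divide_inverse)
  have "frechet_derivative ?Y (at x) = frechet_derivative (\<lambda>y. ?p (y $ 1) *\<^sub>R e1 + ?q (y $ 1) *\<^sub>R e2) (at x)"
    by (rule frechet_derivative_cong_open[OF open_polar_strip x]) (rule cov_round_const)
  also have "\<dots> = (\<lambda>h. (- (v $ 2 * w $ 2 * ((cos (x $ 1))\<^sup>2 - (sin (x $ 1))\<^sup>2)) * h $ 1) *\<^sub>R e1
      + (- ((v $ 1 * w $ 2 + v $ 2 * w $ 1) / (sin (x $ 1))\<^sup>2) * h $ 1) *\<^sub>R e2)"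
    by (rule frechet_derivative_at[symmetric])
      (rule has_derivative_add[OF has_derivative_radial[OF p] has_derivative_radial[OF q]])
  finally show ?thesis
    using s by (simp add: cov_round[OF x] cov_round_const[OF x] vec_eq_iff forall_2 cot_def
        power2_eq_square algebra_simps)
qed

text \<open>
  The unit sphere has curvature one, so \<open>R(X,Y)Z = \<langle>Y,Z\<rangle> X - \<langle>X,Z\<rangle> Y\<close>; with \<open>X, Z\<close> multiples of \<open>\<partial>\<^sub>\<phi>\<close> and
  \<open>Y\<close> of \<open>\<partial>\<^sub>\<rho>\<close> only the second term survives. These are the values that enter the bitension field of a rotationally
  symmetric map.
\<close>

lemma curv_round:
  assumes x: "x \<in> polar_strip"
  shows "curv round_polar x (a *\<^sub>R e1) (b *\<^sub>R e1) (c *\<^sub>R e1) = 0"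
    "curv round_polar x (a *\<^sub>R e2) (b *\<^sub>R e1) (c *\<^sub>R e2) = (- (a * b * c * (sin (x $ 1))\<^sup>2)) *\<^sub>R e1"
proof -
  have "cov round_polar (lie_bracket (\<lambda>_. u) (\<lambda>_. v)) (\<lambda>_. w) x = 0" for u v w
    by (simp add: cov_round[OF x] lie_bracket_def frechet_derivative_const)
  then show "curv round_polar x (a *\<^sub>R e1) (b *\<^sub>R e1) (c *\<^sub>R e1) = 0"
    "curv round_polar x (a *\<^sub>R e2) (b *\<^sub>R e1) (c *\<^sub>R e2) = (- (a * b * c * (sin (x $ 1))\<^sup>2)) *\<^sub>R e1"
    by (simp_all add: curv_def Rm_def cov_round_cov_const[OF x] vec_eq_iff forall_2 algebra_simps)
qed

text \<open>
  The coordinate expression of a rotationally symmetric map \<open>(r, \<theta>) \<mapsto> (R r, k \<theta> + d)\<close> from a metric conformal to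
  the round one, with conformal factor \<open>w(r)\<close>, to the round sphere. The expressions are prescribed only on the open
  set \<open>U\<close>, since a chart sees the map only locally; the phase \<open>d\<close> absorbs the difference of angle windows.
\<close>

locale rotational_map =
  fixes U :: "(real^2) set" and G :: "real^2 \<Rightarrow> real^2^2" and F :: "real^2 \<Rightarrow> real^2"
    and w w' R R' R'' :: "real \<Rightarrow> real" and k d :: real
  assumes open_U: "open U" and U_strip: "U \<subseteq> polar_strip"
    and G: "\<And>y. y \<in> U \<Longrightarrow> G y = diag2 (w (y $ 1)) (w (y $ 1) * (sin (y $ 1))\<^sup>2)"
    and F: "\<And>y. y \<in> U \<Longrightarrow> F y = R (y $ 1) *\<^sub>R e1 + (k * y $ 2 + d) *\<^sub>R e2"
    and w_pos: "\<And>r. 0 < r \<Longrightarrow> r < pi \<Longrightarrow> w r > 0"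
    and w_deriv: "\<And>r. 0 < r \<Longrightarrow> r < pi \<Longrightarrow> (w has_real_derivative w' r) (at r)"
    and R_bounds: "\<And>r. 0 < r \<Longrightarrow> r < pi \<Longrightarrow> 0 < R r \<and> R r < pi"
    and R_deriv: "\<And>r. 0 < r \<Longrightarrow> r < pi \<Longrightarrow> (R has_real_derivative R' r) (at r)"
    and R'_deriv: "\<And>r. 0 < r \<Longrightarrow> r < pi \<Longrightarrow> (R' has_real_derivative R'' r) (at r)"
begin

definition tension_profile :: "real \<Rightarrow> real" where
  "tension_profile r = (R'' r + cot r * R' r - k\<^sup>2 * (sin (R r) * cos (R r)) / (sin r)\<^sup>2) / w r"

lemma U_bounds:
  assumes "x \<in> U"
  shows "0 < x $ 1" "x $ 1 < pi" "0 < sin (x $ 1)" "0 < w (x $ 1)"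
  using assms U_strip w_pos[of "x $ 1"] polar_strip_sin[of x] by (auto simp: polar_strip_def)

lemma F_bounds: "x \<in> U \<Longrightarrow> F x \<in> polar_strip" "x \<in> U \<Longrightarrow> F x $ 1 = R (x $ 1)"
    "x \<in> U \<Longrightarrow> 0 < sin (R (x $ 1))"
  using R_bounds U_bounds by (auto simp: F polar_strip_def intro!: sin_gt_zero)

lemma matrix_inv_G: "x \<in> U \<Longrightarrow> matrix_inv (G x) = diag2 (1 / w (x $ 1)) (1 / (w (x $ 1) * (sin (x $ 1))\<^sup>2))"
  using U_bounds[of x] by (simp add: G matrix_inv_diag2)

lemma christoffel_G:
  assumes x: "x \<in> U"
  shows "christoffel G 1 1 x = (w' (x $ 1) / (2 * w (x $ 1))) *\<^sub>R e1"
    "christoffel G 2 2 x = (- ((w' (x $ 1) * (sin (x $ 1))\<^sup>2 + 2 * w (x $ 1) * sin (x $ 1) * cos (x $ 1)) / (2 * w (x $ 1)))) *\<^sub>R e1"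
proof -
  note b = U_bounds[OF x]
  have d: "((\<lambda>t. w t * (sin t)\<^sup>2) has_real_derivative
      w' (x $ 1) * (sin (x $ 1))\<^sup>2 + 2 * w (x $ 1) * sin (x $ 1) * cos (x $ 1)) (at (x $ 1))"
    by (auto intro!: derivative_eq_intros w_deriv[OF b(1,2)])
  have nz: "w (x $ 1) \<noteq> 0" "w (x $ 1) * (sin (x $ 1))\<^sup>2 \<noteq> 0" using b by auto
  note * = christoffel_diag2[OF open_U x G w_deriv[OF b(1,2)] nz(1) d nz(2)]
  show "christoffel G 1 1 x = (w' (x $ 1) / (2 * w (x $ 1))) *\<^sub>R e1" by (rule *(1))
  show "christoffel G 2 2 x = (- ((w' (x $ 1) * (sin (x $ 1))\<^sup>2 + 2 * w (x $ 1) * sin (x $ 1) * cos (x $ 1)) / (2 * w (x $ 1)))) *\<^sub>R e1"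
    by (simp only: *(4) minus_divide_left)
qed

lemma pdiff_F:
  assumes x: "x \<in> U"
  shows "pdiff 1 F x = R' (x $ 1) *\<^sub>R e1" "pdiff 2 F x = k *\<^sub>R e2"
proof -
  have "((\<lambda>y. y $ 2) has_derivative (\<lambda>h. h $ 2)) (at x)"
    by (intro bounded_linear_imp_has_derivative bounded_linear_vec_nth)
  then have "((\<lambda>y. (k * y $ 2 + d) *\<^sub>R e2) has_derivative (\<lambda>h. (k * h $ 2) *\<^sub>R e2)) (at x)"
    by (auto intro!: derivative_eq_intros)
  from has_derivative_add[OF has_derivative_radial[OF R_deriv[OF U_bounds(1,2)[OF x]], of e1] this]
  have D: "((\<lambda>y. R (y $ 1) *\<^sub>R e1 + (k * y $ 2 + d) *\<^sub>R e2) has_derivative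
      (\<lambda>h. (R' (x $ 1) * h $ 1) *\<^sub>R e1 + (k * h $ 2) *\<^sub>R e2)) (at x)" .
  have "pdiff i F x = pdiff i (\<lambda>y. R (y $ 1) *\<^sub>R e1 + (k * y $ 2 + d) *\<^sub>R e2) x" for i
    by (rule pdiff_cong_open[OF open_U x]) (rule F)
  then show "pdiff 1 F x = R' (x $ 1) *\<^sub>R e1" "pdiff 2 F x = k *\<^sub>R e2"
    by (simp_all add: pdiff_eq[OF D])
qed

text \<open>
  The covariant derivative of a radial field \<open>u \<partial>\<^sub>\<rho>\<close> is radial in the direction \<open>r\<close> and angular in the direction
  \<open>\<theta>\<close>; a second derivative in the direction \<open>\<theta>\<close> makes it radial again. So radial fields are preserved by second
  order operators that are diagonal in these directions.
\<close>

lemma pull_cov_radial: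
  assumes x: "x \<in> U" and V: "\<And>y. y \<in> U \<Longrightarrow> V y = u (y $ 1) *\<^sub>R e1"
    and u: "(u has_real_derivative u') (at (x $ 1))"
  shows "pull_cov round_polar F 1 V x = u' *\<^sub>R e1"
    "pull_cov round_polar F 2 V x = (k * u (x $ 1) * cot (R (x $ 1))) *\<^sub>R e2"
proof -
  have "pdiff i V x = pdiff i (\<lambda>y. u (y $ 1) *\<^sub>R e1) x" for i
    by (rule pdiff_cong_open[OF open_U x]) (rule V)
  then show "pull_cov round_polar F 1 V x = u' *\<^sub>R e1"
    "pull_cov round_polar F 2 V x = (k * u (x $ 1) * cot (R (x $ 1))) *\<^sub>R e2"
    by (simp_all add: pull_cov_def sum_2 pdiff_radial_vec[OF u] pdiff_F[OF x] V[OF x]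
        christoffel_round[OF F_bounds(1)[OF x]] F_bounds(2)[OF x])
qed

lemma pull_cov_angular:
  assumes x: "x \<in> U" and V: "\<And>y. y \<in> U \<Longrightarrow> V y = v (y $ 1) *\<^sub>R e2"
    and v: "(v has_real_derivative v') (at (x $ 1))"
  shows "pull_cov round_polar F 2 V x = (- (k * v (x $ 1) * (sin (R (x $ 1)) * cos (R (x $ 1))))) *\<^sub>R e1"
proof -
  have "pdiff 2 V x = pdiff 2 (\<lambda>y. v (y $ 1) *\<^sub>R e2) x"
    by (rule pdiff_cong_open[OF open_U x]) (rule V)
  then show ?thesis
    by (simp add: pull_cov_def sum_2 pdiff_radial_vec[OF v] pdiff_F[OF x] V[OF x]
        christoffel_round[OF F_bounds(1)[OF x]] F_bounds(2)[OF x])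
qed

lemma trace_G:
  assumes x: "x \<in> U"
  shows "(\<Sum>i\<in>UNIV. \<Sum>j\<in>UNIV. matrix_inv (G x) $ i $ j *\<^sub>R A i j) =
    (1 / w (x $ 1)) *\<^sub>R A 1 1 + (1 / (w (x $ 1) * (sin (x $ 1))\<^sup>2)) *\<^sub>R (A 2 2 :: 'b::real_vector)"
  by (simp add: sum_2 matrix_inv_G[OF x])

text \<open>
  The trace of a second derivative minus its Christoffel correction, where \<open>a\<close> and \<open>b\<close> are the second derivatives
  in the directions \<open>r\<close> and \<open>\<theta>\<close> and \<open>c\<close> is the first derivative in the direction \<open>r\<close>. The two terms with \<open>w'\<close>
  cancel: this is the conformal invariance special to dimension two. It is applied to the tension field, to the rough
  Laplacian and to the Laplacian of functions.
\<close>

lemma conformal_trace: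
  assumes x: "x \<in> U"
  shows "(1 / w (x $ 1)) *\<^sub>R (a *\<^sub>R e1 - (w' (x $ 1) / (2 * w (x $ 1)) * c) *\<^sub>R e1)
    + (1 / (w (x $ 1) * (sin (x $ 1))\<^sup>2)) *\<^sub>R (b *\<^sub>R e1
      - (- ((w' (x $ 1) * (sin (x $ 1))\<^sup>2 + 2 * w (x $ 1) * sin (x $ 1) * cos (x $ 1)) / (2 * w (x $ 1))) * c) *\<^sub>R e1)
    = ((a + cot (x $ 1) * c + b / (sin (x $ 1))\<^sup>2) / w (x $ 1)) *\<^sub>R e1"
proof -
  have nz: "w (x $ 1) \<noteq> 0" "sin (x $ 1) \<noteq> 0" using U_bounds[OF x] by auto
  have "(1 / W) * (a - W' / (2 * W) * c) + (1 / (W * s\<^sup>2)) * (b + ((W' * s\<^sup>2 + 2 * W * s * co) / (2 * W)) * c)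
      = (a + co / s * c + b / s\<^sup>2) / W" if "W \<noteq> 0" "s \<noteq> 0" for W W' s co :: real
    using that by (simp add: field_simps power2_eq_square)
  from this[OF nz] show ?thesis
    by (simp add: vec_eq_iff forall_2 cot_def)
qed

lemma tension_coord_eq:
  assumes x: "x \<in> U"
  shows "tension_coord G round_polar F x = tension_profile (x $ 1) *\<^sub>R e1"
proof -
  note b = U_bounds[OF x]
  have "pull_cov round_polar F 1 (pdiff 1 F) x = R'' (x $ 1) *\<^sub>R e1"
    by (rule pull_cov_radial(1)[OF x pdiff_F(1) R'_deriv[OF b(1,2)]])
  moreover have "pull_cov round_polar F 2 (pdiff 2 F) x
      = (- (k * k * (sin (R (x $ 1)) * cos (R (x $ 1))))) *\<^sub>R e1"
    by (rule pull_cov_angular[OF x pdiff_F(2) DERIV_const])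
  ultimately show ?thesis
    using conformal_trace[OF x, of "R'' (x $ 1)" "R' (x $ 1)" "- (k * k * (sin (R (x $ 1)) * cos (R (x $ 1))))"]
    unfolding tension_coord_def trace_G[OF x]
    by (simp add: sum_2 christoffel_G[OF x] pdiff_F[OF x] tension_profile_def power2_eq_square)
qed

text \<open>
  The rough Laplacian contributes \<open>- k\<^sup>2 cos\<^sup>2 R\<close> and the curvature \<open>+ k\<^sup>2 sin\<^sup>2 R\<close> to the coefficient of
  \<open>u / (w sin\<^sup>2 r)\<close>; together they are \<open>- k\<^sup>2 cos (2R)\<close>.
\<close>

lemma bitension_coord_eq:
  assumes x: "x \<in> U"
    and T: "\<And>r. 0 < r \<Longrightarrow> r < pi \<Longrightarrow> tension_profile r = u r"
    and u: "\<And>r. 0 < r \<Longrightarrow> r < pi \<Longrightarrow> (u has_real_derivative u' r) (at r)"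
    and u': "\<And>r. 0 < r \<Longrightarrow> r < pi \<Longrightarrow> (u' has_real_derivative u'' r) (at r)"
  shows "bitension_coord G round_polar F x =
    ((u'' (x $ 1) + cot (x $ 1) * u' (x $ 1) - k\<^sup>2 * cos (2 * R (x $ 1)) / (sin (x $ 1))\<^sup>2 * u (x $ 1)) / w (x $ 1)) *\<^sub>R e1"
proof -
  let ?T = "tension_coord G round_polar F"
  let ?v = "\<lambda>r. k * u r * cot (R r)"
  note b = U_bounds[OF x]
  have T': "?T y = u (y $ 1) *\<^sub>R e1" if "y \<in> U" for y
    using tension_coord_eq[OF that] T U_bounds[OF that] by simp
  have n1: "pull_cov round_polar F 1 ?T y = u' (y $ 1) *\<^sub>R e1" if "y \<in> U" for y
    by (rule pull_cov_radial(1)[OF that T' u[OF U_bounds(1,2)[OF that]]])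
  have n2: "pull_cov round_polar F 2 ?T y = ?v (y $ 1) *\<^sub>R e2" if "y \<in> U" for y
    by (rule pull_cov_radial(2)[OF that T' u[OF U_bounds(1,2)[OF that]]])
  have n11: "pull_cov round_polar F 1 (pull_cov round_polar F 1 ?T) x = u'' (x $ 1) *\<^sub>R e1"
    by (rule pull_cov_radial(1)[OF x n1 u'[OF b(1,2)]])
  have s: "sin (R (x $ 1)) \<noteq> 0" using F_bounds(3)[OF x] by simp
  have "((\<lambda>r. cot (R r)) has_real_derivative - inverse ((sin (R (x $ 1)))\<^sup>2) * R' (x $ 1)) (at (x $ 1))"
    by (rule DERIV_chain2[OF DERIV_cot[OF s] R_deriv[OF b(1,2)]])
  from DERIV_mult[OF DERIV_cmult[OF u[OF b(1,2)], of k] this]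
  \<comment> \<open>Only the existence of this derivative matters: the next covariant derivative is in the direction \<open>\<theta>\<close>.\<close>
  obtain v' where v: "(?v has_real_derivative v') (at (x $ 1))" by blast
  have n22: "pull_cov round_polar F 2 (pull_cov round_polar F 2 ?T) x
      = (- (k * ?v (x $ 1) * (sin (R (x $ 1)) * cos (R (x $ 1))))) *\<^sub>R e1"
    by (rule pull_cov_angular[where v = ?v and V = "pull_cov round_polar F 2 ?T", OF x n2 v])
  have n22': "- (k * ?v (x $ 1) * (sin (R (x $ 1)) * cos (R (x $ 1)))) = - (k\<^sup>2 * u (x $ 1) * (cos (R (x $ 1)))\<^sup>2)"
    using s by (simp add: cot_def power2_eq_square)
  have rough: "rough_laplace_coord G round_polar F ?T x
      = ((u'' (x $ 1) + cot (x $ 1) * u' (x $ 1) + (- (k\<^sup>2 * u (x $ 1) * (cos (R (x $ 1)))\<^sup>2)) / (sin (x $ 1))\<^sup>2) / w (x $ 1)) *\<^sub>R e1"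
    using conformal_trace[OF x, of "u'' (x $ 1)" "u' (x $ 1)" "- (k\<^sup>2 * u (x $ 1) * (cos (R (x $ 1)))\<^sup>2)"]
    unfolding rough_laplace_coord_def trace_G[OF x] n11 n22 n22'
    by (simp add: sum_2 christoffel_G[OF x] n1[OF x] n2[OF x])
  have "(\<Sum>i\<in>UNIV. \<Sum>j\<in>UNIV. matrix_inv (G x) $ i $ j *\<^sub>R
          curv round_polar (F x) (pdiff i F x) (?T x) (pdiff j F x))
      = (- (k * u (x $ 1) * k * (sin (R (x $ 1)))\<^sup>2) / (w (x $ 1) * (sin (x $ 1))\<^sup>2)) *\<^sub>R e1"
    unfolding trace_G[OF x] T'[OF x] pdiff_F[OF x] curv_round[OF F_bounds(1)[OF x]] F_bounds(2)[OF x]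
    by (simp add: vec_eq_iff forall_2)
  then show ?thesis
    unfolding bitension_coord_def rough
    by (simp add: vec_eq_iff forall_2 cos_double power2_eq_square)
      (simp add: diff_divide_distrib add_divide_distrib algebra_simps)
qed

lemma laplace_coord_eq:
  assumes x: "x \<in> U"
    and h: "\<And>y. y \<in> U \<Longrightarrow> h y = f (y $ 1)"
    and f: "\<And>r. 0 < r \<Longrightarrow> r < pi \<Longrightarrow> (f has_real_derivative f' r) (at r)"
    and f': "\<And>r. 0 < r \<Longrightarrow> r < pi \<Longrightarrow> (f' has_real_derivative f'' r) (at r)"
  shows "laplace_coord G h x = (f'' (x $ 1) + cot (x $ 1) * f' (x $ 1)) / w (x $ 1)"
    and "grad_coord G h x = (f' (x $ 1) / w (x $ 1)) *\<^sub>R e1"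
proof -
  have d: "pdiff 1 h y = f' (y $ 1)" "pdiff 2 h y = 0" if "y \<in> U" for y
  proof -
    have "pdiff i h y = pdiff i (\<lambda>y. f (y $ 1)) y" for i
      by (rule pdiff_cong_open[OF open_U that]) (rule h)
    then show "pdiff 1 h y = f' (y $ 1)" "pdiff 2 h y = 0"
      by (simp_all add: pdiff_radial[OF f[OF U_bounds(1,2)[OF that]]])
  qed
  have "pdiff 1 (pdiff 1 h) x = pdiff 1 (\<lambda>y. f' (y $ 1)) x"
    by (rule pdiff_cong_open[OF open_U x]) (rule d(1))
  then have d11: "pdiff 1 (pdiff 1 h) x = f'' (x $ 1)"
    by (simp add: pdiff_radial[OF f'[OF U_bounds(1,2)[OF x]]])
  have "pdiff 2 (pdiff 2 h) x = pdiff 2 (\<lambda>y. 0 :: real) x"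
    by (rule pdiff_cong_open[OF open_U x]) (rule d(2))
  then have d22: "pdiff 2 (pdiff 2 h) x = 0" by (simp add: pdiff_const)
  show "laplace_coord G h x = (f'' (x $ 1) + cot (x $ 1) * f' (x $ 1)) / w (x $ 1)"
    using arg_cong[OF conformal_trace[OF x, of "f'' (x $ 1)" "f' (x $ 1)" 0], of "\<lambda>v. v $ 1"]
    unfolding laplace_coord_def real_scaleR_def[symmetric] trace_G[OF x]
    by (simp add: sum_2 christoffel_G[OF x] d11 d22 d[OF x])
  show "grad_coord G h x = (f' (x $ 1) / w (x $ 1)) *\<^sub>R e1"
    by (simp add: grad_coord_def matrix_inv_G[OF x] matrix_vector_mult_def vec_eq_iff forall_2 sum_2 d[OF x])
qed

lemma grad_cov_tension_coord_eq:
  assumes x: "x \<in> U"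
    and h: "\<And>y. y \<in> U \<Longrightarrow> h y = f (y $ 1)"
    and f: "\<And>r. 0 < r \<Longrightarrow> r < pi \<Longrightarrow> (f has_real_derivative f' r) (at r)"
    and f': "\<And>r. 0 < r \<Longrightarrow> r < pi \<Longrightarrow> (f' has_real_derivative f'' r) (at r)"
    and T: "\<And>r. 0 < r \<Longrightarrow> r < pi \<Longrightarrow> tension_profile r = u r"
    and u: "\<And>r. 0 < r \<Longrightarrow> r < pi \<Longrightarrow> (u has_real_derivative u' r) (at r)"
  shows "grad_cov_tension_coord h G round_polar F x = (f' (x $ 1) * u' (x $ 1) / w (x $ 1)) *\<^sub>R e1"
proof -
  have T': "tension_coord G round_polar F y = u (y $ 1) *\<^sub>R e1" if "y \<in> U" for y
    using tension_coord_eq[OF that] T U_bounds[OF that] by simp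
  have "pull_cov round_polar F 1 (tension_coord G round_polar F) x = u' (x $ 1) *\<^sub>R e1"
    by (rule pull_cov_radial(1)[OF x T' u[OF U_bounds(1,2)[OF x]]])
  then show ?thesis
    unfolding grad_cov_tension_coord_def
    by (simp add: sum_2 laplace_coord_eq(2)[where h = h and f = f and f' = f' and f'' = f'', OF x h f f'])
qed

end

section \<open>The target radius, the conformal factor and the Jacobi equation\<close>

definition target_radius :: "real \<Rightarrow> real" where
  "target_radius r = 1/2 * arccos ((sin (r/2))^2)"

definition target_radius' :: "real \<Rightarrow> real" where
  "target_radius' r = - (1/2) * sqrt ((1 - cos r) / (3 - cos r))"

definition target_radius'' :: "real \<Rightarrow> real" where
  "target_radius'' r = - sin r / (2 * (3 - cos r)\<^sup>2 * sqrt ((1 - cos r) / (3 - cos r)))"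

lemma cos_bounds:
  assumes "0 < r" "r < pi"
  shows "- 1 < cos r" "cos r < 1" "0 < 1 + cos r" "0 < 1 - cos r" "0 < 3 - cos r" "0 < sin r"
proof -
  show "- 1 < cos r" using assms cos_monotone_0_pi[of r pi] by simp
  moreover show "cos r < 1" using assms cos_monotone_0_pi[of 0 r] by simp
  ultimately show "0 < 1 + cos r" "0 < 1 - cos r" "0 < 3 - cos r" by simp_all
  show "0 < sin r" using assms by (rule sin_gt_zero)
qed

lemma sin_half_squared: "(sin (r/2))\<^sup>2 = (1 - cos r) / 2" for r :: real
  using cos_double_sin[of "r/2"] by simp

lemma cos_half_squared: "(cos (r/2))\<^sup>2 = (1 + cos r) / 2" for r :: real
  using cos_double_cos[of "r/2"] by simp

lemma sin_squared_factored: "(sin r)\<^sup>2 = (1 - cos r) * (1 + cos r)" for r :: real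
  by (simp add: sin_squared_eq power2_eq_square algebra_simps)

lemma target_radius_eq: "target_radius r = arccos ((1 - cos r) / 2) / 2"
  by (simp add: target_radius_def sin_half_squared)

lemma target_radius_bounds:
  assumes "0 < r" "r < pi"
  shows "0 < target_radius r" "target_radius r < pi / 2"
proof -
  have "- 1 < (1 - cos r) / 2" "(1 - cos r) / 2 < 1" using cos_bounds[OF assms] by simp_all
  from arccos_lt_bounded[OF this]
  show "0 < target_radius r" "target_radius r < pi / 2" by (simp_all add: target_radius_eq)
qed

lemma cos_double_target_radius:
  assumes "0 < r" "r < pi"
  shows "cos (2 * target_radius r) = (1 - cos r) / 2"
  using cos_bounds[OF assms] by (simp add: target_radius_eq)

lemma cos_target_radius:
  assumes r: "0 < r" "r < pi"
  shows "cos (target_radius r) = sqrt (3 - cos r) / 2"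
proof -
  have "(cos (target_radius r))\<^sup>2 = (3 - cos r) / 4"
    using cos_double_cos[of "target_radius r"] cos_double_target_radius[OF r] by simp
  moreover have "0 < cos (target_radius r)"
    using target_radius_bounds[OF r] by (intro cos_gt_zero)
  ultimately have "cos (target_radius r) = sqrt ((3 - cos r) / 4)"
    by (intro real_sqrt_unique[symmetric]) simp_all
  then show ?thesis by (simp add: real_sqrt_divide)
qed

lemma sin_target_radius:
  assumes r: "0 < r" "r < pi"
  shows "sin (target_radius r) = sqrt (1 + cos r) / 2"
proof -
  have "(sin (target_radius r))\<^sup>2 = (1 + cos r) / 4"
    using cos_double_sin[of "target_radius r"] cos_double_target_radius[OF r] by simp
  moreover have "0 < sin (target_radius r)"
    using target_radius_bounds[OF r] pi_gt_zero by (intro sin_gt_zero) linarith+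
  ultimately have "sin (target_radius r) = sqrt ((1 + cos r) / 4)"
    by (intro real_sqrt_unique[symmetric]) simp_all
  then show ?thesis by (simp add: real_sqrt_divide)
qed

text \<open>
  Everything below becomes rational in \<open>sin r\<close>, \<open>sqrt (1 + cos r)\<close> and \<open>sqrt (3 - cos r)\<close>; these roots are twice the sine and the
  cosine of the target radius.
\<close>

lemma sqrt_ratio:
  assumes r: "0 < r" "r < pi"
  shows "sqrt ((1 - cos r) / (3 - cos r)) = sin r / (sqrt (1 + cos r) * sqrt (3 - cos r))"
proof (rule real_sqrt_unique)
  note b = cos_bounds[OF r]
  have "(sqrt (1 + cos r))\<^sup>2 = 1 + cos r" "(sqrt (3 - cos r))\<^sup>2 = 3 - cos r" using b by simp_all
  then show "(sin r / (sqrt (1 + cos r) * sqrt (3 - cos r)))\<^sup>2 = (1 - cos r) / (3 - cos r)"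
    unfolding power_divide power_mult_distrib sin_squared_factored using b by simp
  show "0 \<le> sin r / (sqrt (1 + cos r) * sqrt (3 - cos r))" using b by simp
qed

lemma target_radius_deriv:
  assumes r: "0 < r" "r < pi"
  shows "(target_radius has_real_derivative target_radius' r) (at r)"
proof -
  note b = cos_bounds[OF r]
  have "1 - ((1 - cos r) / 2)\<^sup>2 = (sqrt (1 + cos r) * sqrt (3 - cos r) / 2)\<^sup>2"
    using b by (simp add: power_divide power_mult_distrib power2_eq_square[of "1 - cos r"] field_simps)
  then have s: "sqrt (1 - ((1 - cos r) / 2)\<^sup>2) = sqrt (1 + cos r) * sqrt (3 - cos r) / 2"
    using b by simp
  have a: "(arccos has_real_derivative inverse (- sqrt (1 - ((1 - cos r) / 2)\<^sup>2))) (at ((1 - cos r) / 2))"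
    using b by (intro DERIV_arccos) simp_all
  have i: "((\<lambda>r. (1 - cos r) / 2) has_real_derivative sin r / 2) (at r)"
    by (auto intro!: derivative_eq_intros)
  have "target_radius = (\<lambda>r. arccos ((1 - cos r) / 2) / 2)"
    by (rule ext) (rule target_radius_eq)
  moreover have "((\<lambda>r. arccos ((1 - cos r) / 2)) has_real_derivative
      inverse (- sqrt (1 - ((1 - cos r) / 2)\<^sup>2)) * (sin r / 2)) (at r)"
    using i a by (rule DERIV_chain')
  then have "((\<lambda>r. arccos ((1 - cos r) / 2) / 2) has_real_derivative
      inverse (- sqrt (1 - ((1 - cos r) / 2)\<^sup>2)) * (sin r / 2) / 2) (at r)"
    by (rule DERIV_cdivide)
  moreover have "inverse (- sqrt (1 - ((1 - cos r) / 2)\<^sup>2)) * (sin r / 2) / 2 = target_radius' r"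
  proof -
    have "inverse (- (X / 2)) * (y / 2) / 2 = - (1/2) * (y / X)" for X y :: real
      by (cases "X = 0") (simp_all add: field_simps)
    then show ?thesis unfolding s target_radius'_def sqrt_ratio[OF r] .
  qed
  ultimately show ?thesis by (simp only:)
qed

lemma target_radius'_deriv:
  assumes r: "0 < r" "r < pi"
  shows "(target_radius' has_real_derivative target_radius'' r) (at r)"
proof -
  note b = cos_bounds[OF r]
  have h: "((\<lambda>r. (1 - cos r) / (3 - cos r)) has_real_derivative
      (sin r * (3 - cos r) - (1 - cos r) * sin r) / ((3 - cos r) * (3 - cos r))) (at r)"
    using b by (auto intro!: derivative_eq_intros)
  have p: "0 < (1 - cos r) / (3 - cos r)" using b by simp
  have "(target_radius' has_real_derivative - (1/2) * (inverse (sqrt ((1 - cos r) / (3 - cos r))) / 2 *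
      ((sin r * (3 - cos r) - (1 - cos r) * sin r) / ((3 - cos r) * (3 - cos r))))) (at r)"
    unfolding target_radius'_def[abs_def]
    by (rule DERIV_cmult[OF DERIV_chain2[where g = "\<lambda>r. (1 - cos r) / (3 - cos r)", OF DERIV_real_sqrt[OF p] h]])
  moreover have "- (1/2) * (inverse S / 2 * ((sin r * (3 - cos r) - (1 - cos r) * sin r) / ((3 - cos r) * (3 - cos r))))
      = - sin r / (2 * (3 - cos r)\<^sup>2 * S)" for S
  proof -
    have "- (1/2) * (inverse S / 2 * (2 * y / (z * z))) = - y / (2 * z\<^sup>2 * S)" for y z :: real
      by (cases "S = 0"; cases "z = 0") (simp_all add: field_simps power2_eq_square)
    moreover have "sin r * (3 - cos r) - (1 - cos r) * sin r = 2 * sin r" by (simp add: algebra_simps)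
    ultimately show ?thesis by (simp only:)
  qed
  ultimately show ?thesis unfolding target_radius''_def by (simp only:)
qed

text \<open>
  With \<open>c = cos r\<close>, this cubic is the denominator of the conformal factor multiplied by \<open>(1 + c)\<^sup>2 (1 - c)\<close>; up to
  sign it is also the numerator of the tension profile.
\<close>

definition denominator :: "real \<Rightarrow> real" where
  "denominator c = 19 - 9 * c - 3 * c\<^sup>2 + c ^ 3"

lemma denominator_pos:
  assumes "\<bar>c\<bar> \<le> 1"
  shows "0 < denominator c"
proof -
  have "c\<^sup>2 \<le> 1" using assms by (simp add: abs_square_le_1)
  moreover have "\<bar>c ^ 3\<bar> \<le> 1" using assms power_le_one[of "\<bar>c\<bar>" 3] by (simp add: power_abs)
  ultimately show ?thesis using assms unfolding denominator_def by linarith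
qed

text \<open>
  The conformal factor \<open>f\<close> in terms of \<open>cos r\<close>, obtained from \<open>tan\<^sup>2 (r/2) = (1 - cos r) / (1 + cos r)\<close>. The powers
  make its logarithm a sum, so \<open>f\<close> is differentiated through its logarithmic derivative.
\<close>

definition weight :: "real \<Rightarrow> real" where
  "weight r = 8 * (1 - cos r) * (3 - cos r) powr (3/2) * (1 + cos r) powr (- 1/2) / denominator (cos r)"

definition log_weight' :: "real \<Rightarrow> real" where
  "log_weight' r = sin r * (1 / (1 - cos r) + 3 / (2 * (3 - cos r)) + 1 / (2 * (1 + cos r))
     + (3 * (cos r)\<^sup>2 - 6 * cos r - 9) / denominator (cos r))"

definition log_weight'' :: "real \<Rightarrow> real" where
  "log_weight'' r = cos r * (1 / (1 - cos r) + 3 / (2 * (3 - cos r)) + 1 / (2 * (1 + cos r))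
     + (3 * (cos r)\<^sup>2 - 6 * cos r - 9) / denominator (cos r))
   - (sin r)\<^sup>2 * (1 / (1 - cos r)\<^sup>2 + 3 / (2 * (3 - cos r)\<^sup>2) - 1 / (2 * (1 + cos r)\<^sup>2)
     + ((6 * cos r - 6) * denominator (cos r) - (3 * (cos r)\<^sup>2 - 6 * cos r - 9)\<^sup>2) / (denominator (cos r))\<^sup>2)"

lemma denominator_cos_pos: "0 < denominator (cos r)"
  by (rule denominator_pos) simp

lemma weight_pos:
  assumes "0 < r" "r < pi"
  shows "0 < weight r"
  using cos_bounds[OF assms] denominator_cos_pos[of r] by (simp add: weight_def)

lemma weight_formula:
  assumes r: "0 < r" "r < pi"
  shows "4 * (1 + (tan (r/2))^2) * (1 + 2 * (tan (r/2))^2) powr (3/2)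
        / (3 * (tan (r/2))^4 + 9 * (tan (r/2))^2 + 6 + (cot (r/2))^2) = weight r"
proof -
  note b = cos_bounds[OF r]
  define c where "c = cos r"
  have c: "0 < 1 + c" "0 < 1 - c" "0 < 3 - c" "0 < denominator c"
    using b denominator_cos_pos by (simp_all add: c_def)
  have t: "(tan (r/2))\<^sup>2 = (1 - c) / (1 + c)" "(cot (r/2))\<^sup>2 = (1 + c) / (1 - c)"
  proof -
    have "(a / 2) / (b / 2) = a / b" for a b :: real by simp
    then show "(tan (r/2))\<^sup>2 = (1 - c) / (1 + c)" "(cot (r/2))\<^sup>2 = (1 + c) / (1 - c)"
      by (simp_all only: tan_def cot_def power_divide sin_half_squared cos_half_squared c_def)
  qed
  have t4: "(tan (r/2)) ^ 4 = ((1 - c) / (1 + c))\<^sup>2"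
  proof -
    have "x ^ 4 = (x\<^sup>2)\<^sup>2" for x :: real by (simp add: power_mult[symmetric])
    then show ?thesis by (simp only: t(1))
  qed
  have q: "1 + (1 - c) / (1 + c) = 2 / (1 + c)" "1 + 2 * ((1 - c) / (1 + c)) = (3 - c) / (1 + c)"
    using c by (simp_all add: field_simps)
  have "((3 - c) / (1 + c)) powr (3/2) = (3 - c) powr (3/2) * (1 + c) powr (- (3/2))"
    using c by (simp add: powr_divide powr_minus_divide)
  also have "(1 + c) powr (- (3/2)) = (1 + c) powr (- 1/2) / (1 + c)"
    using c powr_diff[of "1 + c" "- 1/2" 1] by simp
  finally have pw: "((3 - c) / (1 + c)) powr (3/2) = (3 - c) powr (3/2) * (1 + c) powr (- 1/2) / (1 + c)" by simp
  have d: "3 * ((1 - c) / (1 + c))\<^sup>2 + 9 * ((1 - c) / (1 + c)) + 6 + (1 + c) / (1 - c)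
      = denominator c / ((1 + c)\<^sup>2 * (1 - c))"
  proof -
    have ratio: "3 * (y / x)\<^sup>2 + 9 * (y / x) + 6 + x / y = (3 * y ^ 3 + 9 * y\<^sup>2 * x + 6 * y * x\<^sup>2 + x ^ 3) / (x\<^sup>2 * y)"
      if "x \<noteq> 0" "y \<noteq> 0" for x y :: real
      using that by (simp add: field_simps power2_eq_square power3_eq_cube)
    have num: "3 * (1 - c) ^ 3 + 9 * (1 - c)\<^sup>2 * (1 + c) + 6 * (1 - c) * (1 + c)\<^sup>2 + (1 + c) ^ 3 = denominator c"
      by (simp add: denominator_def power2_eq_square power3_eq_cube algebra_simps)
    have "1 + c \<noteq> 0" "1 - c \<noteq> 0" using c by simp_all
    show ?thesis unfolding ratio[OF \<open>1 + c \<noteq> 0\<close> \<open>1 - c \<noteq> 0\<close>] num by (rule refl)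
  qed
  have cancel: "4 * (2 / (1 + c)) * (P / (1 + c)) / (denominator c / ((1 + c)\<^sup>2 * (1 - c)))
      = 8 * (1 - c) * P / denominator c" for P
  proof -
    have "4 * (2 / x) * (P / x) / (D / (x\<^sup>2 * y)) = 8 * y * P / D" if "x \<noteq> 0" for x y D :: real
      using that by (simp add: power2_eq_square)
    moreover have "1 + c \<noteq> 0" using c by simp
    ultimately show ?thesis .
  qed
  show ?thesis
    unfolding t4 t q pw d weight_def c_def[symmetric] cancel by (simp only: mult.assoc)
qed

lemma exp_log_weight:
  fixes a b d k :: real
  assumes "0 < a" "0 < b" "0 < d" "0 < k"
  shows "exp (ln 8 + ln a + 3/2 * ln b - 1/2 * ln d - ln k) = 8 * a * b powr (3/2) * d powr (- 1/2) / k"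
proof -
  have "b powr (3/2) = exp (3/2 * ln b)" "d powr (- 1/2) = inverse (exp (1/2 * ln d))"
    using assms by (simp_all add: powr_def exp_minus[symmetric])
  moreover have "exp (ln 8) = (8::real)" "exp (ln a) = a" "exp (ln k) = k" using assms by simp_all
  ultimately show ?thesis by (simp only: exp_add exp_diff divide_inverse)
qed

lemma DERIV_ln_compose:
  fixes g :: "real \<Rightarrow> real"
  assumes g: "(g has_real_derivative g') (at x)" and pos: "0 < g x"
  shows "((\<lambda>x. ln (g x)) has_real_derivative g' / g x) (at x)"
  using DERIV_chain2[where g = g, OF DERIV_ln_divide[OF pos] g] by simp

lemma weight_deriv:
  assumes r: "0 < r" "r < pi"
  shows "(weight has_real_derivative weight r * log_weight' r) (at r)"
proof -
  let ?h = "\<lambda>r. ln 8 + ln (1 - cos r) + 3/2 * ln (3 - cos r) - 1/2 * ln (1 + cos r) - ln (denominator (cos r))"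
  have eq: "exp (?h s) = weight s" if "s \<in> {0<..<pi}" for s
  proof -
    have "0 < 1 - cos s" "0 < 3 - cos s" "0 < 1 + cos s" using cos_bounds[of s] that by simp_all
    from exp_log_weight[OF this denominator_cos_pos[of s]] show ?thesis by (simp only: weight_def)
  qed
  note b = cos_bounds[OF r]
  have "((\<lambda>r. denominator (cos r)) has_real_derivative - sin r * (3 * (cos r)\<^sup>2 - 6 * cos r - 9)) (at r)"
    unfolding denominator_def by (auto intro!: derivative_eq_intros simp: algebra_simps power2_eq_square)
  then have l4: "((\<lambda>r. ln (denominator (cos r))) has_real_derivative
      - sin r * (3 * (cos r)\<^sup>2 - 6 * cos r - 9) / denominator (cos r)) (at r)"
    by (rule DERIV_ln_compose) (rule denominator_cos_pos)
  have l1: "((\<lambda>r. ln (1 - cos r)) has_real_derivative sin r / (1 - cos r)) (at r)"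
    using b by (intro DERIV_ln_compose) (auto intro!: derivative_eq_intros)
  have l2: "((\<lambda>r. ln (3 - cos r)) has_real_derivative sin r / (3 - cos r)) (at r)"
    using b by (intro DERIV_ln_compose) (auto intro!: derivative_eq_intros)
  have l3: "((\<lambda>r. ln (1 + cos r)) has_real_derivative - sin r / (1 + cos r)) (at r)"
    using b by (intro DERIV_ln_compose) (auto intro!: derivative_eq_intros)
  from DERIV_diff[OF DERIV_diff[OF DERIV_add[OF DERIV_add[OF DERIV_const l1] DERIV_cmult[OF l2]] DERIV_cmult[OF l3]] l4]
  have "(?h has_real_derivative 0 + sin r / (1 - cos r) + 3/2 * (sin r / (3 - cos r))
      - 1/2 * (- sin r / (1 + cos r)) - - sin r * (3 * (cos r)\<^sup>2 - 6 * cos r - 9) / denominator (cos r)) (at r)" .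
  moreover have "0 + s / x + 3/2 * (s / y) - 1/2 * (- s / z) - - s * q / v
      = s * (1 / x + 3 / (2 * y) + 1 / (2 * z) + q / v)" for s x y z q v :: real
    by (simp add: distrib_left)
  ultimately have "(?h has_real_derivative log_weight' r) (at r)"
    unfolding log_weight'_def by (simp only:)
  then have "((\<lambda>r. exp (?h r)) has_real_derivative exp (?h r) * log_weight' r) (at r)"
    by (rule DERIV_fun_exp)
  moreover have "exp (?h r) = weight r" using r by (intro eq) simp
  ultimately have "((\<lambda>r. exp (?h r)) has_real_derivative weight r * log_weight' r) (at r)" by (simp only:)
  then show ?thesis
  proof (rule has_field_derivative_transform_within_open[where S = "{0<..<pi}"])
    show "r \<in> {0<..<pi}" using r by simp
  qed (simp, rule eq)
qed

lemma DERIV_const_divide: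
  fixes g :: "real \<Rightarrow> real"
  assumes "(g has_real_derivative g') (at x)" "g x \<noteq> 0"
  shows "((\<lambda>x. a / g x) has_real_derivative - (a * g') / (g x)\<^sup>2) (at x)"
  using DERIV_divide[OF DERIV_const assms, of a] by (simp add: power2_eq_square)

lemma log_weight'_deriv:
  assumes r: "0 < r" "r < pi"
  shows "(log_weight' has_real_derivative log_weight'' r) (at r)"
proof -
  note b = cos_bounds[OF r]
  let ?K = "\<lambda>c. 1 / (1 - c) + 3 / (2 * (3 - c)) + 1 / (2 * (1 + c)) + (3 * c\<^sup>2 - 6 * c - 9) / denominator c"
  let ?K' = "\<lambda>c. 1 / (1 - c)\<^sup>2 + 3 / (2 * (3 - c)\<^sup>2) - 1 / (2 * (1 + c)\<^sup>2)
     + ((6 * c - 6) * denominator c - (3 * c\<^sup>2 - 6 * c - 9)\<^sup>2) / (denominator c)\<^sup>2"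
  have D: "(denominator has_real_derivative 3 * c\<^sup>2 - 6 * c - 9) (at c)" for c
    unfolding denominator_def by (auto intro!: derivative_eq_intros simp: algebra_simps power2_eq_square)
  have "(?K has_real_derivative ?K' (cos r)) (at (cos r))"
  proof -
    note b' = b denominator_cos_pos[of r]
    have d1: "((\<lambda>c. 1 / (1 - c)) has_real_derivative - (1 * - 1) / (1 - cos r)\<^sup>2) (at (cos r))"
      using b' by (intro DERIV_const_divide) (auto intro!: derivative_eq_intros)
    have d2: "((\<lambda>c. 3 / (2 * (3 - c))) has_real_derivative - (3 * - 2) / (2 * (3 - cos r))\<^sup>2) (at (cos r))"
      using b' by (intro DERIV_const_divide) (auto intro!: derivative_eq_intros)
    have d3: "((\<lambda>c. 1 / (2 * (1 + c))) has_real_derivative - (1 * 2) / (2 * (1 + cos r))\<^sup>2) (at (cos r))"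
      using b' by (intro DERIV_const_divide) (auto intro!: derivative_eq_intros)
    have d4: "((\<lambda>c. (3 * c\<^sup>2 - 6 * c - 9) / denominator c) has_real_derivative
        ((6 * cos r - 6) * denominator (cos r) - (3 * (cos r)\<^sup>2 - 6 * cos r - 9)\<^sup>2) / (denominator (cos r))\<^sup>2) (at (cos r))"
      using b' by (auto intro!: derivative_eq_intros D simp: power2_eq_square)
    from DERIV_add[OF DERIV_add[OF DERIV_add[OF d1 d2] d3] d4]
    have sum: "(?K has_real_derivative - (1 * - 1) / (1 - cos r)\<^sup>2 + - (3 * - 2) / (2 * (3 - cos r))\<^sup>2
      + - (1 * 2) / (2 * (1 + cos r))\<^sup>2
      + ((6 * cos r - 6) * denominator (cos r) - (3 * (cos r)\<^sup>2 - 6 * cos r - 9)\<^sup>2) / (denominator (cos r))\<^sup>2) (at (cos r))" .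
    have "- (1 * - 1) / x + - (3 * - 2) / (2 * y)\<^sup>2 + - (1 * 2) / (2 * z)\<^sup>2 + v
        = 1 / x + 3 / (2 * y\<^sup>2) - 1 / (2 * z\<^sup>2) + v" for x y z v :: real
      by (simp add: power_mult_distrib)
    with sum show ?thesis by (simp only:)
  qed
  from DERIV_mult[OF DERIV_sin DERIV_chain2[where g = cos, OF this DERIV_cos]]
  have "(log_weight' has_real_derivative cos r * ?K (cos r) + ?K' (cos r) * - sin r * sin r) (at r)"
    unfolding log_weight'_def[abs_def] .
  moreover have "cos r * x + y * - sin r * sin r = cos r * x - (sin r)\<^sup>2 * y" for x y
    by (simp add: power2_eq_square)
  ultimately show ?thesis unfolding log_weight''_def by (simp only:)
qed

text \<open>
  The solution of the Jacobi equation, with its first two derivatives. It equals \<open>- 2 (1 + tan\<^sup>2 (r/2))\<close>.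
\<close>

definition jacobi :: "real \<Rightarrow> real" where "jacobi r = - 4 / (1 + cos r)"
definition jacobi' :: "real \<Rightarrow> real" where "jacobi' r = - 4 * sin r / (1 + cos r)\<^sup>2"
definition jacobi'' :: "real \<Rightarrow> real" where "jacobi'' r = - 4 * (2 - cos r) / (1 + cos r)\<^sup>2"

lemma jacobi_deriv:
  assumes r: "0 < r" "r < pi"
  shows "(jacobi has_real_derivative jacobi' r) (at r)" "(jacobi' has_real_derivative jacobi'' r) (at r)"
proof -
  have nz: "1 + cos r \<noteq> 0" using cos_bounds[OF r] by simp
  show "(jacobi has_real_derivative jacobi' r) (at r)"
    unfolding jacobi_def[abs_def] jacobi'_def using nz
    by (auto intro!: derivative_eq_intros simp: power2_eq_square)
  have n: "((\<lambda>r. - 4 * sin r) has_real_derivative - 4 * cos r) (at r)"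
    by (auto intro!: derivative_eq_intros)
  have d: "((\<lambda>r. (1 + cos r)\<^sup>2) has_real_derivative 2 * (1 + cos r) * (- sin r)) (at r)"
    by (auto intro!: derivative_eq_intros)
  have "(jacobi' has_real_derivative
     (- 4 * cos r * (1 + cos r)\<^sup>2 - (- 4 * sin r) * (2 * (1 + cos r) * (- sin r))) / ((1 + cos r)\<^sup>2 * (1 + cos r)\<^sup>2)) (at r)"
    unfolding jacobi'_def[abs_def] using nz by (intro DERIV_divide n d) simp
  moreover
  have "(- 4 * c * (1 + c)\<^sup>2 - (- 4 * s) * (2 * (1 + c) * (- s))) / ((1 + c)\<^sup>2 * (1 + c)\<^sup>2) = - 4 * (2 - c) / (1 + c)\<^sup>2"
    if "s\<^sup>2 = (1 - c) * (1 + c)" "1 + c \<noteq> 0" for s c :: real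
  proof -
    have "- 4 * c * (1 + c)\<^sup>2 - (- 4 * s) * (2 * (1 + c) * (- s)) = - 4 * c * (1 + c)\<^sup>2 - 8 * (1 + c) * s\<^sup>2"
      by (simp add: power2_eq_square algebra_simps)
    also have "\<dots> = (- 4 * (2 - c)) * (1 + c)\<^sup>2"
      unfolding that(1) by (simp add: power2_eq_square algebra_simps)
    finally have num: "- 4 * c * (1 + c)\<^sup>2 - (- 4 * s) * (2 * (1 + c) * (- s)) = (- 4 * (2 - c)) * (1 + c)\<^sup>2" .
    have "(m * p) / (p * p) = m / p" if "p \<noteq> 0" for m p :: real using that by simp
    then show ?thesis unfolding num using that(2) by (metis power_not_zero)
  qed
  note this[OF sin_squared_factored[of r] nz]
  ultimately show "(jacobi' has_real_derivative jacobi'' r) (at r)"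
    unfolding jacobi''_def by (simp only:)
qed

text \<open>
  The coefficient of the zeroth order term is \<open>4 cos (2R) / sin\<^sup>2 r = 2 / (1 + cos r)\<close>.
\<close>

lemma jacobi_equation:
  assumes r: "0 < r" "r < pi"
  shows "jacobi'' r + cot r * jacobi' r - 2\<^sup>2 * cos (2 * target_radius r) / (sin r)\<^sup>2 * jacobi r = 0"
proof -
  note b = cos_bounds[OF r]
  have m: "2\<^sup>2 * cos (2 * target_radius r) / (sin r)\<^sup>2 = 2 / (1 + cos r)"
  proof -
    have cancel: "2\<^sup>2 * (z / 2) / (z * y) = 2 / y" if "z \<noteq> 0" for z y :: real
      using that by simp
    have "1 - cos r \<noteq> 0" using b by simp
    then show ?thesis unfolding cos_double_target_radius[OF r] sin_squared_factored by (rule cancel)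
  qed
  have ct: "cot r * jacobi' r = - 4 * cos r / (1 + cos r)\<^sup>2"
    using b by (simp add: cot_def jacobi'_def)
  have "- 4 * (2 - c) / x\<^sup>2 + - 4 * c / x\<^sup>2 - 2 / x * (- 4 / x) = 0" for c x :: real
    by (cases "x = 0") (simp_all add: field_simps power2_eq_square)
  then show ?thesis unfolding m ct jacobi_def jacobi''_def .
qed

text \<open>
  This is where the choice of \<open>f\<close> enters. With \<open>A = sqrt (1 + cos r)\<close>, \<open>B = sqrt (3 - cos r)\<close> and \<open>c = cos r\<close>, both
  sides are \<open>- denominator c / (2 A B\<^sup>3 (1 - c))\<close>.
\<close>

lemma tension_eq_jacobi_over_weight:
  assumes r: "0 < r" "r < pi"
  shows "target_radius'' r + cot r * target_radius' r
      - 2\<^sup>2 * (sin (target_radius r) * cos (target_radius r)) / (sin r)\<^sup>2 = jacobi r / weight r"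
proof -
  note b = cos_bounds[OF r]
  define A B c s where "A = sqrt (1 + cos r)" and "B = sqrt (3 - cos r)" and "c = cos r" and "s = sin r"
  have pos: "0 < A" "0 < B" "0 < 1 - c" "0 < s" "0 < denominator c"
    using b denominator_cos_pos by (simp_all add: A_def B_def c_def s_def)
  have A2: "A\<^sup>2 = 1 + c" and B2: "B\<^sup>2 = 3 - c" and s2: "s\<^sup>2 = (1 - c) * A\<^sup>2"
    using b by (simp_all add: A_def B_def c_def s_def sin_squared_factored)
  have B3: "B ^ 3 = (3 - c) powr (3/2)"
    using b by (simp add: B_def c_def powr_half_sqrt[symmetric] powr_powr powr_realpow[symmetric])
  have A1: "1 / A = (1 + c) powr (- 1/2)"
    using b powr_minus_divide[of "1 + cos r" "1/2"] by (simp add: A_def c_def powr_half_sqrt)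
  have "weight r = 8 * (1 - c) * B ^ 3 * (1 / A) / denominator c"
    unfolding weight_def c_def[symmetric] A1 B3 ..
  then have "jacobi r / weight r = - 4 / A\<^sup>2 * (A * denominator c / (8 * (1 - c) * B ^ 3))"
    by (simp add: jacobi_def A2 c_def)
  also have "\<dots> = - denominator c / (2 * A * B ^ 3 * (1 - c))"
    using pos by (simp add: field_simps power2_eq_square)
  finally have rhs: "jacobi r / weight r = - denominator c / (2 * A * B ^ 3 * (1 - c))" .
  have r1: "target_radius' r = - s / (2 * A * B)"
    by (simp add: target_radius'_def sqrt_ratio[OF r] A_def B_def s_def)
  have "target_radius'' r = - s / (2 * (B\<^sup>2)\<^sup>2 * (s / (A * B)))"
    unfolding target_radius''_def sqrt_ratio[OF r] B2 by (simp add: A_def B_def s_def c_def)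
  then have r2: "target_radius'' r = - A / (2 * B ^ 3)"
    using pos by (simp add: field_simps power2_eq_square power3_eq_cube)
  have sc: "2\<^sup>2 * (sin (target_radius r) * cos (target_radius r)) / (sin r)\<^sup>2 = B / (A * (1 - c))"
    using pos by (simp add: sin_target_radius[OF r] cos_target_radius[OF r] A_def[symmetric] B_def[symmetric]
        s_def[symmetric] s2) (simp add: power2_eq_square)
  have "- A / (2 * B ^ 3) + c / s * (- s / (2 * A * B)) - B / (A * (1 - c))
      = - (A\<^sup>2 * (1 - c) + c * B\<^sup>2 * (1 - c) + 2 * B\<^sup>2 * B\<^sup>2) / (2 * A * B ^ 3 * (1 - c))"
    using pos by (simp add: field_simps power2_eq_square power3_eq_cube)
  also have "A\<^sup>2 * (1 - c) + c * B\<^sup>2 * (1 - c) + 2 * B\<^sup>2 * B\<^sup>2 = denominator c"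
    unfolding A2 B2 denominator_def by (simp add: power2_eq_square power3_eq_cube algebra_simps)
  finally show ?thesis
    unfolding rhs r1 r2 sc unfolding cot_def c_def[symmetric] s_def[symmetric] .
qed

text \<open>
  The first two derivatives of the tension profile \<open>T = u / f\<close>. Since the derivative of \<open>f\<close> is \<open>f l\<close> with the
  logarithmic derivative \<open>l\<close>, differentiating \<open>v / f\<close> replaces \<open>v\<close> by \<open>v' - l v\<close>.
\<close>

definition tension' :: "real \<Rightarrow> real" where
  "tension' r = (jacobi' r - log_weight' r * jacobi r) / weight r"

definition tension'' :: "real \<Rightarrow> real" where
  "tension'' r = (jacobi'' r - (log_weight'' r * jacobi r + jacobi' r * log_weight' r)
      - log_weight' r * (jacobi' r - log_weight' r * jacobi r)) / weight r"

lemma divide_weight_deriv: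
  assumes r: "0 < r" "r < pi" and v: "(v has_real_derivative v') (at r)"
  shows "((\<lambda>r. v r / weight r) has_real_derivative (v' - log_weight' r * v r) / weight r) (at r)"
proof -
  have nz: "weight r \<noteq> 0" using weight_pos[OF r] by simp
  have "(v' * weight r - v r * (weight r * log_weight' r)) / (weight r * weight r) = (v' - log_weight' r * v r) / weight r"
    using nz by (simp add: field_simps)
  with DERIV_divide[OF v weight_deriv[OF r] nz] show ?thesis by (simp only:)
qed

lemma tension_deriv:
  assumes r: "0 < r" "r < pi"
  shows "((\<lambda>r. jacobi r / weight r) has_real_derivative tension' r) (at r)"
    "(tension' has_real_derivative tension'' r) (at r)"
proof -
  show "((\<lambda>r. jacobi r / weight r) has_real_derivative tension' r) (at r)"
    unfolding tension'_def by (rule divide_weight_deriv[OF r jacobi_deriv(1)[OF r]])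
  have t: "tension' = (\<lambda>r. (jacobi' r - log_weight' r * jacobi r) / weight r)"
    by (rule ext) (rule tension'_def)
  have d: "((\<lambda>r. jacobi' r - log_weight' r * jacobi r) has_real_derivative
      jacobi'' r - (log_weight'' r * jacobi r + jacobi' r * log_weight' r)) (at r)"
    by (rule DERIV_diff[OF jacobi_deriv(2)[OF r] DERIV_mult[OF log_weight'_deriv[OF r] jacobi_deriv(1)[OF r]]])
  show "(tension' has_real_derivative tension'' r) (at r)"
    unfolding t tension''_def by (rule divide_weight_deriv[OF r d])
qed

lemma weight'_deriv:
  assumes r: "0 < r" "r < pi"
  shows "((\<lambda>r. weight r * log_weight' r) has_real_derivative
    weight r * ((log_weight' r)\<^sup>2 + log_weight'' r)) (at r)"
proof -
  have "w * l * l + m * w = w * (l\<^sup>2 + m)" for w l m :: real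
    by (simp add: power2_eq_square algebra_simps)
  with DERIV_mult[OF weight_deriv[OF r] log_weight'_deriv[OF r]] show ?thesis by (simp only:)
qed

text \<open>
  The f-biharmonic equation for the profile \<open>T = u / f\<close> is the Jacobi equation for \<open>u = f T\<close>. Here \<open>l\<close> is the
  logarithmic derivative of \<open>f\<close>, \<open>ct\<close> is \<open>cot r\<close> and \<open>m\<close> is the coefficient of the zeroth order term; the three
  summands come from the bitension field, from the Laplacian of \<open>f\<close> and from the gradient of \<open>f\<close>.
\<close>

lemma product_rule_jacobi:
  fixes f :: real
  assumes "f \<noteq> 0"
  shows "f * ((u'' - (l' * u + u' * l) - l * (u' - l * u)) / f + ct * ((u' - l * u) / f) - m * (u / f))
    + (f * (l\<^sup>2 + l') + ct * (f * l)) * (u / f) + 2 * (f * l * ((u' - l * u) / f)) = u'' + ct * u' - m * u"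
proof -
  let ?b = "u' - l * u" and ?a = "u'' - (l' * u + u' * l) - l * (u' - l * u)"
  have 1: "f * (a / f + ct * (b / f) - m * (u / f)) = a + ct * b - m * u" for a b
    using assms by (simp add: distrib_left right_diff_distrib)
  have 2: "(f * x + ct * (f * l)) * (u / f) = (x + ct * l) * u" for x
    using assms by (simp add: distrib_right add_divide_distrib)
  have 3: "2 * (f * l * (b / f)) = 2 * l * b" for b using assms by simp
  show ?thesis unfolding 1 2 3 by (simp add: algebra_simps power2_eq_square)
qed

text \<open>
  At the equator all quantities are rational up to the factor \<open>1 / f\<close>, and the value is \<open>136 / (57 f)\<close>.
\<close>

lemma tension_not_jacobi:
  "tension'' (pi/2) + cot (pi/2) * tension' (pi/2)
    - 2\<^sup>2 * cos (2 * target_radius (pi/2)) / (sin (pi/2))\<^sup>2 * (jacobi (pi/2) / weight (pi/2)) \<noteq> 0"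
proof -
  have r: "0 < pi/2" "pi/2 < pi" by simp_all
  have v: "jacobi (pi/2) = - 4" "jacobi' (pi/2) = - 4" "jacobi'' (pi/2) = - 8"
    by (simp_all add: jacobi_def jacobi'_def jacobi''_def)
  have l: "log_weight' (pi/2) = 29/19" "log_weight'' (pi/2) = - 2/3 + 195/361"
    by (simp_all add: log_weight'_def log_weight''_def denominator_def power2_eq_square)
  have "cos (2 * target_radius (pi/2)) = 1/2" using cos_double_target_radius[OF r] by simp
  then have m: "2\<^sup>2 * cos (2 * target_radius (pi/2)) / (sin (pi/2))\<^sup>2 = 2" by simp
  have "tension'' (pi/2) = (- 8 - ((- 2/3 + 195/361) * (- 4) + (- 4) * (29/19)) - 29/19 * (- 4 - 29/19 * (- 4))) / weight (pi/2)"
    unfolding tension''_def v l ..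
  also have "\<dots> = (136/57 - 8) / weight (pi/2)" by simp
  finally have "tension'' (pi/2) = (136/57 - 8) / weight (pi/2)" .
  moreover have "cot (pi/2) = (0 :: real)" by (simp add: cot_def)
  ultimately have "tension'' (pi/2) + cot (pi/2) * tension' (pi/2)
      - 2\<^sup>2 * cos (2 * target_radius (pi/2)) / (sin (pi/2))\<^sup>2 * (jacobi (pi/2) / weight (pi/2))
    = (136/57 - 8) / weight (pi/2) + 0 * tension' (pi/2) - 2 * (- 4 / weight (pi/2))"
    unfolding m v(1) by (simp only:)
  also have "\<dots> = (136/57) / weight (pi/2)"
    by (simp add: diff_divide_distrib)
  finally have "tension'' (pi/2) + cot (pi/2) * tension' (pi/2)
      - 2\<^sup>2 * cos (2 * target_radius (pi/2)) / (sin (pi/2))\<^sup>2 * (jacobi (pi/2) / weight (pi/2))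
    = (136/57) / weight (pi/2)" .
  then show ?thesis using weight_pos[OF r] by simp
qed

section \<open>Rotationally symmetric maps between spheres\<close>

lemma metric_at_round_sphere:
  assumes "q \<notin> {north, south}"
  shows "metric_at round_sphere q = round_polar"
proof
  fix x
  have "metric_at round_sphere q x = diag2 1 (1 * (sin (x $ 1))\<^sup>2)"
  proof (rule metric_at_sphere)
    show "bij (\<lambda>i::3. i)" by (rule bij_id[unfolded id_def])
    show "param_at round_sphere q = (\<lambda>x. permute_coords (\<lambda>i. i) (polar_param x))"
      by (simp add: round_sphere_def sphere_chart_nonpole[OF assms] permute_coords_id)
    show "rmetric round_sphere (param_at round_sphere q x) v w = 1 * (v \<bullet> w)" for v w
      by (simp add: round_sphere_def round_metric_def)
  qed
  then show "metric_at round_sphere q x = round_polar x" by (simp add: round_polar_def)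
qed

lemma sphere_chart_coords:
  fixes M :: "(real^3, 2) rmanifold"
  assumes chart: "chart_at M = sphere_chart" and q: "q \<in> sphere 0 1 - {north, south}"
  shows "dom_at M q = polar_dom (azimuth q)" "param_at M q = polar_param"
    and "coords_at M q q \<in> polar_dom (azimuth q)" "polar_param (coords_at M q q) = q"
    and "x \<in> polar_dom (azimuth q) \<Longrightarrow> coords_at M q (polar_param x) = x"
proof -
  have c: "chart_at M q = (polar_dom (azimuth q), polar_param)"
    using q by (simp add: chart sphere_chart_nonpole)
  then show d: "dom_at M q = polar_dom (azimuth q)" and p: "param_at M q = polar_param" by simp_all
  have "q \<in> polar_param ` polar_dom (azimuth q)"
    using mem_sphere_chart[of q] q by (simp add: sphere_chart_nonpole)
  then show "coords_at M q q \<in> polar_dom (azimuth q)" "polar_param (coords_at M q q) = q"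
    unfolding coords_at_def d p by (rule inv_into_into, rule f_inv_into_f)
  show "coords_at M q (polar_param x) = x" if "x \<in> polar_dom (azimuth q)"
    unfolding coords_at_def d p
    by (rule inv_into_f_f[OF inj_on_inverseI that]) (rule polar_coords_polar_param)
qed

lemma tangent_vec_round_sphere:
  assumes q: "q \<in> sphere 0 1 - {north, south}"
  shows "linear (tangent_vec round_sphere q)" "v \<noteq> 0 \<Longrightarrow> tangent_vec round_sphere q v \<noteq> 0"
proof -
  have ch: "chart_at round_sphere = sphere_chart" by (simp add: round_sphere_def)
  note c = sphere_chart_coords[OF ch q]
  let ?y = "coords_at round_sphere q q"
  have d: "(polar_param has_derivative polar_param_deriv ?y) (at ?y)"
    using has_derivative_permute_polar_param[of "\<lambda>i. i" ?y] by (simp add: permute_coords_id)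
  have t: "tangent_vec round_sphere q = polar_param_deriv ?y"
    unfolding tangent_vec_def c(2) frechet_derivative_at[OF d, symmetric] ..
  have l: "linear (polar_param_deriv ?y)" by (rule has_derivative_linear[OF d])
  then show "linear (tangent_vec round_sphere q)" unfolding t .
  have "inj (polar_param_deriv ?y)" by (rule inj_polar_param_deriv[OF polar_dom_bounds(1,2)[OF c(3)] refl])
  then show "tangent_vec round_sphere q v \<noteq> 0" if "v \<noteq> 0"
    using that linear_injective_0[OF l] unfolding t by blast
qed

text \<open>
  The angle of the image point in its own chart differs from \<open>2\<theta>\<close> by a multiple of \<open>2\<pi>\<close>, which becomes the phase
  \<open>d\<close>. Around the point the angle stays within the open window of that chart, so the coordinate expression of the
  map is \<open>(R r, 2\<theta> + d)\<close> on an open set.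
\<close>

lemma rotational_map_in_charts:
  fixes g :: "real^3 \<Rightarrow> real^3 \<Rightarrow> real^3 \<Rightarrow> real" and \<phi> :: "real^3 \<Rightarrow> real^3" and p :: "real^3"
  assumes \<phi>: "\<And>r \<theta>. 0 < r \<Longrightarrow> r < pi \<Longrightarrow> \<phi> (sph r \<theta>) = sph (R r) (2 * \<theta>)"
    and g: "\<And>p v w. g p v w = h p * (v \<bullet> w)"
    and h: "\<And>r \<theta>. 0 < r \<Longrightarrow> r < pi \<Longrightarrow> h (sph r \<theta>) = w r"
    and w_pos: "\<And>r. 0 < r \<Longrightarrow> r < pi \<Longrightarrow> w r > 0"
    and w_deriv: "\<And>r. 0 < r \<Longrightarrow> r < pi \<Longrightarrow> (w has_real_derivative w' r) (at r)"
    and R_bounds: "\<And>r. 0 < r \<Longrightarrow> r < pi \<Longrightarrow> 0 < R r \<and> R r < pi"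
    and R_deriv: "\<And>r. 0 < r \<Longrightarrow> r < pi \<Longrightarrow> (R has_real_derivative R' r) (at r)"
    and R'_deriv: "\<And>r. 0 < r \<Longrightarrow> r < pi \<Longrightarrow> (R' has_real_derivative R'' r) (at r)"
    and p: "p \<in> sphere 0 1 - {north, south}"
  obtains U d where
    "rotational_map U (metric_at (punctured_sphere g) p) (coord_map (punctured_sphere g) round_sphere \<phi> p) w w' R R' R'' 2 d"
    "coords_at (punctured_sphere g) p p \<in> U"
proof -
  let ?M = "punctured_sphere g" and ?q = "\<phi> p"
  have chM: "chart_at ?M = sphere_chart" and chN: "chart_at round_sphere = sphere_chart"
    by (simp_all add: punctured_sphere_def round_sphere_def)
  note M = sphere_chart_coords[OF chM p]
  define x0 where "x0 = coords_at ?M p p"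
  have x0: "x0 \<in> polar_dom (azimuth p)" "p = sph (x0 $ 1) (x0 $ 2)"
    using M(3,4) by (simp_all add: x0_def polar_param_def)
  note b0 = polar_dom_bounds(1,2)[OF x0(1)]
  have q: "?q = sph (R (x0 $ 1)) (2 * x0 $ 2)" using \<phi>[OF b0] x0(2) by simp
  have qs: "?q \<in> sphere 0 1 - {north, south}"
    unfolding q using R_bounds[OF b0] by (intro sph_in_punctured) simp_all
  note N = sphere_chart_coords[OF chN qs]
  define y0 where "y0 = coords_at round_sphere ?q ?q"
  have y0: "y0 \<in> polar_dom (azimuth ?q)" "sph (y0 $ 1) (y0 $ 2) = sph (R (x0 $ 1)) (2 * x0 $ 2)"
    using N(3,4) q by (simp_all add: y0_def polar_param_def)
  then obtain k :: int where k: "y0 $ 2 = 2 * x0 $ 2 + 2 * pi * k"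
    using sph_eq_iff[of "y0 $ 1" "R (x0 $ 1)" "y0 $ 2" "2 * x0 $ 2"] polar_dom_bounds(1,2)[OF y0(1)] R_bounds[OF b0]
    by auto
  define d where "d = 2 * pi * k"
  define U where "U = polar_dom (azimuth p) \<inter> {x. azimuth ?q - pi < 2 * x $ 2 + d \<and> 2 * x $ 2 + d < azimuth ?q + pi}"
  have xb: "0 < x $ 1" "x $ 1 < pi" if "x \<in> U" for x
    using that polar_dom_bounds(1,2)[of x "azimuth p"] by (simp_all add: U_def)
  have "open {x :: real^2. azimuth ?q - pi < 2 * x $ 2 + d \<and> 2 * x $ 2 + d < azimuth ?q + pi}"
    by (intro open_Collect_conj open_Collect_less continuous_intros)
  then have "open U" unfolding U_def by (intro open_Int open_polar_dom)
  moreover have "U \<subseteq> polar_strip" using xb by (auto simp: polar_strip_def)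
  moreover have "metric_at ?M p x = diag2 (w (x $ 1)) (w (x $ 1) * (sin (x $ 1))\<^sup>2)" if x: "x \<in> U" for x
  proof (rule metric_at_sphere)
    show "bij (\<lambda>i::3. i)" by (rule bij_id[unfolded id_def])
    show "param_at ?M p = (\<lambda>x. permute_coords (\<lambda>i. i) (polar_param x))"
      by (simp add: M(2) permute_coords_id)
    show "rmetric ?M (param_at ?M p x) v u = w (x $ 1) * (v \<bullet> u)" for v u
      unfolding M(2) using h[OF xb[OF x]] by (simp add: punctured_sphere_def g polar_param_def)
  qed
  moreover have "coord_map ?M round_sphere \<phi> p x = R (x $ 1) *\<^sub>R e1 + (2 * x $ 2 + d) *\<^sub>R e2" if x: "x \<in> U" for x
  proof -
    define y where "y = R (x $ 1) *\<^sub>R e1 + (2 * x $ 2 + d) *\<^sub>R e2"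
    have "y \<in> polar_dom (azimuth ?q)"
      using x R_bounds[OF xb[OF x]] by (simp add: y_def polar_dom_def U_def)
    moreover have "\<phi> (polar_param x) = polar_param y"
    proof -
      have "sph (R (x $ 1)) (2 * x $ 2) = sph (R (x $ 1)) (2 * x $ 2 + d)"
        using sph_eq_iff[of "R (x $ 1)" "R (x $ 1)" "2 * x $ 2 + d" "2 * x $ 2"] R_bounds[OF xb[OF x]]
        unfolding d_def by auto
      then show ?thesis using \<phi>[OF xb[OF x]] by (simp add: polar_param_def y_def)
    qed
    ultimately show ?thesis unfolding coord_map_def y_def[symmetric] using N(5)[of y] by (simp add: M(2))
  qed
  ultimately have "rotational_map U (metric_at ?M p) (coord_map ?M round_sphere \<phi> p) w w' R R' R'' 2 d"
    using w_pos w_deriv R_bounds R_deriv R'_deriv by (intro rotational_map.intro)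
  moreover have "x0 \<in> U"
    using x0(1) y0(1) k by (auto simp: U_def d_def polar_dom_def)
  ultimately show thesis using that unfolding x0_def by blast
qed

lemma smooth_on_weight: "smooth_on (polar_dom c) (\<lambda>x. weight (x $ 1))"
proof -
  have b: "0 < 1 + cos (x $ 1)" "0 < 1 - cos (x $ 1)" "0 < 3 - cos (x $ 1)" if "x \<in> polar_dom c" for x
    using cos_bounds[OF polar_dom_bounds(1,2)[OF that]] by simp_all
  show ?thesis
    unfolding weight_def denominator_def
    by (intro smooth_on_divide smooth_on_mult smooth_on_powr smooth_on_add smooth_on_diff smooth_on_power
        smooth_on_cos smooth_on_const smooth_on_nth open_polar_dom b denominator_cos_pos[unfolded denominator_def])
qed

text \<open>
  The ambient coordinates of the image contain the radius only through its sine and cosine, which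
  are square roots of positive smooth functions.
\<close>

lemma smooth_on_doubling_map:
  "smooth_on (polar_dom c) (\<lambda>x. sph (target_radius (x $ 1)) (2 * x $ 2))"
proof (rule smooth_on_cong[OF open_polar_dom])
  have b: "0 < 1 + cos (x $ 1)" "0 < 3 - cos (x $ 1)" if "x \<in> polar_dom c" for x
    using cos_bounds[OF polar_dom_bounds(1,2)[OF that]] by simp_all
  let ?F = "\<lambda>x::real^2. vector [sqrt (1 + cos (x $ 1)) * (1/2) * cos (2 * x $ 2),
      sqrt (1 + cos (x $ 1)) * (1/2) * sin (2 * x $ 2), sqrt (3 - cos (x $ 1)) * (1/2)] :: real^3"
  show "smooth_on (polar_dom c) ?F"
  proof (rule smooth_on_vec[OF open_polar_dom])
    note sm = smooth_on_mult smooth_on_sqrt smooth_on_add smooth_on_diff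
        smooth_on_cos smooth_on_sin smooth_on_const smooth_on_nth open_polar_dom b
    have 1: "smooth_on (polar_dom c) (\<lambda>x. sqrt (1 + cos (x $ 1)) * (1/2) * cos (2 * x $ 2))"
      by (intro sm)
    have 2: "smooth_on (polar_dom c) (\<lambda>x. sqrt (1 + cos (x $ 1)) * (1/2) * sin (2 * x $ 2))"
      by (intro sm)
    have 3: "smooth_on (polar_dom c) (\<lambda>x. sqrt (3 - cos (x $ 1)) * (1/2))"
      by (intro sm)
    fix j :: 3
    consider "j = 1" | "j = 2" | "j = 3" using exhaust_3 by blast
    then show "smooth_on (polar_dom c) (\<lambda>x. ?F x $ j)"
      using 1 2 3 by cases (simp_all only: vector_3)
  qed
  fix x assume "x \<in> polar_dom c"
  note bx = polar_dom_bounds(1,2)[OF this]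
  show "?F x = sph (target_radius (x $ 1)) (2 * x $ 2)"
    by (simp add: sph_def sin_target_radius[OF bx] cos_target_radius[OF bx])
qed

theorem theorem3p2:
  fixes f :: "real \<Rightarrow> real" and \<phi> :: "real^3 \<Rightarrow> real^3"
  assumes f: "\<And>r. 0 < r \<Longrightarrow> r < pi \<Longrightarrow>
      f r = 4 * (1 + (tan (r/2))^2) * (1 + 2 * (tan (r/2))^2) powr (3/2)
        / (3 * (tan (r/2))^4 + 9 * (tan (r/2))^2 + 6 + (cot (r/2))^2)"
    and \<phi>: "\<And>r \<theta>. 0 < r \<Longrightarrow> r < pi \<Longrightarrow>
      \<phi> (sph r \<theta>) = sph (1/2 * arccos ((sin (r/2))^2)) (2 * \<theta>)"
  shows "proper_biharmonic
           (punctured_sphere (\<lambda>p v w. inverse (f (polar_radius p)) * round_metric p v w))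
           round_sphere \<phi>
       \<and> proper_f_biharmonic (\<lambda>p. f (polar_radius p))
           (punctured_sphere round_metric) round_sphere \<phi>"
proof -
  let ?S = "sphere 0 1 - {north, south} :: (real^3) set"
  let ?u = "\<lambda>p. f (polar_radius p)"
  let ?g = "\<lambda>p v w. inverse (?u p) * round_metric p v w"
  let ?M1 = "punctured_sphere ?g" and ?M0 = "punctured_sphere round_metric"
  have fw: "f r = weight r" if "0 < r" "r < pi" for r
    using f[OF that] weight_formula[OF that] by simp
  have \<phi>': "\<phi> (sph r \<theta>) = sph (target_radius r) (2 * \<theta>)" if "0 < r" "r < pi" for r \<theta>
    using \<phi>[OF that] by (simp add: target_radius_def)
  have u: "?u (sph r \<theta>) = weight r" if "0 < r" "r < pi" for r \<theta>
    using that by (simp add: polar_radius_sph fw)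
  have S: "\<exists>r \<theta>. 0 < r \<and> r < pi \<and> p = sph r \<theta>" if "p \<in> ?S" for p
    using sph_surj that by blast
  have u_pos: "0 < ?u p" if "p \<in> ?S" for p
    using S[OF that] u weight_pos by metis
  have R_b: "0 < target_radius r \<and> target_radius r < pi" if "0 < r" "r < pi" for r
    using target_radius_bounds[OF that] pi_gt_zero by linarith
  have \<phi>_S: "\<phi> p \<in> ?S" if "p \<in> ?S" for p
  proof -
    from S[OF that] obtain r \<theta> where "0 < r" "r < pi" "p = sph r \<theta>" by blast
    then show ?thesis using R_b[of r] by (simp only: \<phi>') (intro sph_in_punctured; simp)
  qed
  have pts: "pts (punctured_sphere g) = ?S" for g by (simp add: punctured_sphere_def)

  have smooth_u: "smooth_fun (punctured_sphere g) ?u" for g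
  proof (rule smooth_fun_punctured_sphere)
    fix c
    show "smooth_on (polar_dom c) (\<lambda>x. ?u (polar_param x))"
      by (rule smooth_on_cong[OF open_polar_dom smooth_on_weight])
        (use u polar_dom_bounds(1,2) in \<open>simp add: polar_param_def\<close>)
  qed
  have smooth_inv: "smooth_fun (punctured_sphere g) (\<lambda>p. inverse (?u p))" for g
  proof (rule smooth_fun_punctured_sphere)
    fix c
    have "smooth_on (polar_dom c) (\<lambda>x. 1 / weight (x $ 1))"
      by (intro smooth_on_divide smooth_on_const smooth_on_weight open_polar_dom weight_pos polar_dom_bounds)
    then show "smooth_on (polar_dom c) (\<lambda>x. inverse (?u (polar_param x)))"
      by (rule smooth_on_cong[OF open_polar_dom])
        (use u polar_dom_bounds(1,2) in \<open>simp add: polar_param_def divide_inverse\<close>)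
  qed
  have smooth_\<phi>: "smooth_fun (punctured_sphere g) \<phi>" for g
  proof (rule smooth_fun_punctured_sphere)
    fix c
    show "smooth_on (polar_dom c) (\<lambda>x. \<phi> (polar_param x))"
      by (rule smooth_on_cong[OF open_polar_dom smooth_on_doubling_map])
        (use \<phi>' polar_dom_bounds(1,2) in \<open>simp add: polar_param_def\<close>)
  qed
  have "riemannian_manifold ?M1"
    by (rule riemannian_punctured_sphere[where h = "\<lambda>p. inverse (?u p)"])
      (use u_pos smooth_inv in \<open>simp_all add: round_metric_def\<close>)
  moreover have "riemannian_manifold ?M0"
    by (rule riemannian_punctured_sphere[where h = "\<lambda>p. 1"])
      (simp_all add: round_metric_def smooth_fun_punctured_sphere smooth_on_const)
  moreover have "\<phi> ` ?S \<subseteq> pts round_sphere"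
  proof (rule image_subsetI)
    show "\<phi> p \<in> pts round_sphere" if "p \<in> ?S" for p
      using \<phi>_S[OF that] by (simp add: round_sphere_def)
  qed
  ultimately have maps: "smooth_map ?M1 round_sphere \<phi>" "smooth_map ?M0 round_sphere \<phi>"
    using riemannian_round_sphere smooth_\<phi> by (simp_all add: smooth_map_def pts)

  note profile = R_b target_radius_deriv target_radius'_deriv

  \<comment> \<open>The metric \<open>inverse f \<cdot> g\<close>: the tension profile is the solution of the Jacobi equation.\<close>
  have conformal: "tension ?M1 round_sphere \<phi> p \<noteq> 0" "bitension ?M1 round_sphere \<phi> p = 0" if p: "p \<in> ?S" for p
  proof -
    let ?w = "\<lambda>r. 1 / weight r"
    have g1: "?g p v w = inverse (?u p) * (v \<bullet> w)" for p v w by (simp add: round_metric_def)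
    have h1: "inverse (?u (sph r \<theta>)) = ?w r" if "0 < r" "r < pi" for r \<theta>
      using u[OF that] by (simp add: divide_inverse)
    have w1: "?w r > 0" if "0 < r" "r < pi" for r using weight_pos[OF that] by simp
    have w1': "(?w has_real_derivative (0 - log_weight' r * 1) / weight r) (at r)" if "0 < r" "r < pi" for r
      using divide_weight_deriv[OF that DERIV_const[of 1]] .
    obtain U d where "rotational_map U (metric_at ?M1 p) (coord_map ?M1 round_sphere \<phi> p) ?w
        (\<lambda>r. (0 - log_weight' r * 1) / weight r) target_radius target_radius' target_radius'' 2 d"
      and x: "coords_at ?M1 p p \<in> U"
      using rotational_map_in_charts[where h = "\<lambda>p. inverse (?u p)", OF \<phi>' g1 h1 w1 w1' profile p] .
    then interpret rotational_map U "metric_at ?M1 p" "coord_map ?M1 round_sphere \<phi> p" ?w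
        "\<lambda>r. (0 - log_weight' r * 1) / weight r" target_radius target_radius' target_radius'' 2 d by simp
    have T: "tension_profile r = jacobi r" if "0 < r" "r < pi" for r
      unfolding tension_profile_def tension_eq_jacobi_over_weight[OF that] using weight_pos[OF that] by simp
    note b = U_bounds(1,2)[OF x]
    have "metric_at round_sphere (\<phi> p) = round_polar" using \<phi>_S[OF p] by (simp add: metric_at_round_sphere)
    note * = this tangent_vec_round_sphere[OF \<phi>_S[OF p]]
    have "jacobi (coords_at ?M1 p p $ 1) *\<^sub>R e1 \<noteq> 0"
      using cos_bounds[OF b] by (simp add: jacobi_def vec_eq_iff forall_2)
    then show "tension ?M1 round_sphere \<phi> p \<noteq> 0"
      unfolding tension_def *(1) tension_coord_eq[OF x] T[OF b]
      by (rule *(3))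
    have "bitension_coord (metric_at ?M1 p) round_polar (coord_map ?M1 round_sphere \<phi> p) (coords_at ?M1 p p)
        = (0 / (1 / weight (coords_at ?M1 p p $ 1))) *\<^sub>R e1"
      unfolding jacobi_equation[OF b, symmetric]
      by (rule bitension_coord_eq[OF x]) (fact T jacobi_deriv)+
    then show "bitension ?M1 round_sphere \<phi> p = 0"
      unfolding bitension_def *(1) using linear_0[OF *(2)] by simp
  qed

  \<comment> \<open>The round metric: the tension profile is that solution divided by \<open>f\<close>.\<close>
  have round: "tension ?M0 round_sphere \<phi> p \<noteq> 0"
      "?u p *\<^sub>R bitension ?M0 round_sphere \<phi> p + laplace ?M0 ?u p *\<^sub>R tension ?M0 round_sphere \<phi> p
        + 2 *\<^sub>R grad_cov_tension ?u ?M0 round_sphere \<phi> p = 0"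
      "polar_radius p = pi/2 \<Longrightarrow> bitension ?M0 round_sphere \<phi> p \<noteq> 0" if p: "p \<in> ?S" for p
  proof -
    have g1: "round_metric p v w = 1 * (v \<bullet> w)" for p v w by (simp add: round_metric_def)
    obtain U d where "rotational_map U (metric_at ?M0 p) (coord_map ?M0 round_sphere \<phi> p) (\<lambda>_. 1)
        (\<lambda>r. 0) target_radius target_radius' target_radius'' 2 d"
      and x: "coords_at ?M0 p p \<in> U"
      using rotational_map_in_charts[where h = "\<lambda>p. 1" and w = "\<lambda>_. 1" and w' = "\<lambda>_. 0",
          OF \<phi>' g1 refl zero_less_one DERIV_const profile p] .
    then interpret rotational_map U "metric_at ?M0 p" "coord_map ?M0 round_sphere \<phi> p" "\<lambda>_. 1"
        "\<lambda>r. 0" target_radius target_radius' target_radius'' 2 d by simp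
    define r where "r = coords_at ?M0 p p $ 1"
    note r = U_bounds(1,2)[OF x, folded r_def]
    have T: "tension_profile s = jacobi s / weight s" if "0 < s" "s < pi" for s
      unfolding tension_profile_def tension_eq_jacobi_over_weight[OF that] by simp
    have chM: "chart_at ?M0 = sphere_chart" by (simp add: punctured_sphere_def)
    note c = sphere_chart_coords[OF chM p]
    have pr: "p = sph r (coords_at ?M0 p p $ 2)" using c(4) by (simp add: polar_param_def r_def)
    have up: "?u p = weight r" using u[OF r] pr by metis
    have uU: "(?u \<circ> param_at ?M0 p) y = weight (y $ 1)" if "y \<in> U" for y
      using u[OF U_bounds(1,2)[OF that]] by (simp add: c(2) polar_param_def)
    have "metric_at round_sphere (\<phi> p) = round_polar" using \<phi>_S[OF p] by (simp add: metric_at_round_sphere)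
    note * = this tangent_vec_round_sphere[OF \<phi>_S[OF p]]
    have "jacobi r / weight r \<noteq> 0" using cos_bounds[OF r] weight_pos[OF r] by (simp add: jacobi_def)
    then show "tension ?M0 round_sphere \<phi> p \<noteq> 0"
      unfolding tension_def *(1) tension_coord_eq[OF x] r_def[symmetric] T[OF r]
      by (intro *(3)) (simp add: vec_eq_iff forall_2)
    let ?J = "tension'' r + cot r * tension' r - 2\<^sup>2 * cos (2 * target_radius r) / (sin r)\<^sup>2 * (jacobi r / weight r)"
    have bit: "bitension ?M0 round_sphere \<phi> p = tangent_vec round_sphere (\<phi> p) (?J *\<^sub>R e1)"
    proof -
      have "bitension_coord (metric_at ?M0 p) round_polar (coord_map ?M0 round_sphere \<phi> p) (coords_at ?M0 p p)
          = (?J / 1) *\<^sub>R e1"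
        unfolding r_def by (rule bitension_coord_eq[OF x]) (fact T tension_deriv)+
      then show ?thesis unfolding bitension_def *(1) by simp
    qed
    have ten: "tension ?M0 round_sphere \<phi> p = tangent_vec round_sphere (\<phi> p) ((jacobi r / weight r) *\<^sub>R e1)"
      unfolding tension_def *(1) tension_coord_eq[OF x] r_def[symmetric] T[OF r] ..
    have lap: "laplace ?M0 ?u p = weight r * ((log_weight' r)\<^sup>2 + log_weight'' r) + cot r * (weight r * log_weight' r)"
    proof -
      have "laplace_coord (metric_at ?M0 p) (?u \<circ> param_at ?M0 p) (coords_at ?M0 p p)
          = (weight r * ((log_weight' r)\<^sup>2 + log_weight'' r) + cot r * (weight r * log_weight' r)) / 1"
        unfolding r_def by (rule laplace_coord_eq(1)[where f = weight and h = "?u \<circ> param_at ?M0 p", OF x])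
            (fact uU weight_deriv weight'_deriv)+
      then show ?thesis unfolding laplace_def by simp
    qed
    have grad: "grad_cov_tension ?u ?M0 round_sphere \<phi> p
        = tangent_vec round_sphere (\<phi> p) ((weight r * log_weight' r * tension' r) *\<^sub>R e1)"
    proof -
      have "grad_cov_tension_coord (?u \<circ> param_at ?M0 p) (metric_at ?M0 p) round_polar
          (coord_map ?M0 round_sphere \<phi> p) (coords_at ?M0 p p)
          = (weight r * log_weight' r * tension' r / 1) *\<^sub>R e1"
        unfolding r_def
        by (rule grad_cov_tension_coord_eq[where f = weight and h = "?u \<circ> param_at ?M0 p", OF x])
            (fact uU weight_deriv weight'_deriv T tension_deriv)+
      then show ?thesis unfolding grad_cov_tension_def *(1) by simp
    qed
    have nz: "weight r \<noteq> 0" using weight_pos[OF r] by simp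
    have "weight r * ?J + (weight r * ((log_weight' r)\<^sup>2 + log_weight'' r) + cot r * (weight r * log_weight' r)) * (jacobi r / weight r)
        + 2 * (weight r * log_weight' r * tension' r) = 0"
      unfolding tension'_def tension''_def product_rule_jacobi[OF nz] by (rule jacobi_equation[OF r])
    then show "?u p *\<^sub>R bitension ?M0 round_sphere \<phi> p + laplace ?M0 ?u p *\<^sub>R tension ?M0 round_sphere \<phi> p
        + 2 *\<^sub>R grad_cov_tension ?u ?M0 round_sphere \<phi> p = 0"
      unfolding bit ten grad lap up linear_scale[OF *(2), symmetric] linear_add[OF *(2), symmetric]
        scaleR_scaleR scaleR_add_left[symmetric] by (simp only: scaleR_zero_left linear_0[OF *(2)])
    show "bitension ?M0 round_sphere \<phi> p \<noteq> 0" if "polar_radius p = pi/2"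
    proof -
      have "r = pi/2" using that polar_radius_sph[OF r] pr by metis
      then have "?J \<noteq> 0" by (simp only: tension_not_jacobi simp_thms)
      then have "?J *\<^sub>R e1 \<noteq> 0" by (simp only: scaleR_eq_0_iff axis_eq_0_iff zero_neq_one[symmetric] simp_thms)
      then show ?thesis unfolding bit by (rule *(3))
    qed
  qed

  have eq: "sph (pi/2) 0 \<in> ?S" "polar_radius (sph (pi/2) 0) = pi/2"
    using sph_in_punctured[of "pi/2" 0] polar_radius_sph[of "pi/2" 0] pi_gt_zero by simp_all
  show ?thesis
    unfolding proper_biharmonic_def proper_f_biharmonic_def f_biharmonic_def biharmonic_def harmonic_def pts
    using maps smooth_u u_pos conformal round eq by blast
qed

end
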